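(* Let $-1/2<\gamma\le 5/2$. For every $n\ge 2$, the eigenvalues $\lambda$ of the (parity-separated) Gegenbauer Tau discretization of degree $n$ and index $\gamma$ of the problem $u''=\lambda u$ on $(-1,1)$, $u(\pm1)=0$, are real, negative and distinct; that is, the characteristic polynomial $$\Omega_n(\mu)=\sum_{k=0}^{\lfloor n/2\rfloor}\mu^k\,\big(D^{2k}G_n^{(\gamma)}\big)(1),\qquad \mu=1/\lambda,$$ has only real, negative and simple zeros. Moreover, the characteristic polynomials given by approximations of successive orders interlace: for every $n\ge 3$, the zeros of $\Omega_n$ and of $\Omega_{n-1}$ strictly interlace.
   Context: $D=d/dx$. The Gegenbauer polynomials $G_n^{(\gamma)}$ ($\gamma>-1/2$), in a non-standard normalization, are given by $G_0^{(\gamma)}=1$, $G_1^{(\gamma)}=x$, $G_2^{(\gamma)}=(\gamma+1)x^2-\tfrac12$ and $(n+1)G_{n+1}^{(\gamma)}=2(n+\gamma)xG_n^{(\gamma)}-(n-1+2\gamma)G_{n-1}^{(\gamma)}$ for $n\ge2$ (so $G_n^{(\gamma)}=C_n^{(\gamma)}/(2\gamma)$ for $n\ge1$, $\gamma\neq0$, with $C_n^{(\gamma)}$ the standard Gegenbauer polynomial). They are orthogonal on $(-1,1)$ with weight $(1-x^2)^{\gamma-1/2}$, and $G_n^{(\gamma)}$ has the parity of $n$. Parity-separated Gegenbauer Tau discretization of degree $n$: find $\lambda\in\mathbb{C}$ and a nonzero polynomial $u_n$ of degree at most $n$, with $u_n$ even if $n$ is even and odd if $n$ is odd, such that $u_n(\pm1)=0$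 and $\int_{-1}^1(\lambda u_n-u_n'')\,p\,(1-x^2)^{\gamma-1/2}dx=0$ for all polynomials $p$ of degree at most $n-2$. Equivalently $\lambda u_n-u_n''=\tau_0\lambda G_n^{(\gamma)}$ for a constant $\tau_0$. Necessarily $\lambda\ne0$, and $\lambda$ is an eigenvalue if and only if $\mu=1/\lambda$ is a zero of the characteristic polynomial $\Omega_n$. Strict interlacing of polynomials $\Omega_1$ of degree $d$ and $\Omega_2$ of degree $d-1$ (or $d$), with real distinct zeros $\mu_1<\dots<\mu_d$ and $\mu_1'<\mu_2'<\cdots$ respectively, means $\mu_1<\mu'_1<\mu_2<\cdots<\mu'_{d-1}<\mu_d<0$ (or $\mu'_1<\mu_1<\cdots<\mu'_d<\mu_d<0$). Here the first polynomial is $\Omega_n$ and the second is $\Omega_{n-1}$. *)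

theory Defs
  imports "HOL-Analysis.Analysis" "HOL-Computational_Algebra.Polynomial"
begin

text \<open>
  Gegenbauer polynomials in the normalization \<open>C_n^(g) / (2 g)\<close>, extended to \<open>g = 0\<close>.
  The last equation is the three-term recurrence with \<open>n + 2\<close> as its middle index;
  lemma \<open>gegenbauer_recurrence\<close> restates it in the usual form.
\<close>

fun gegenbauer :: "real \<Rightarrow> nat \<Rightarrow> real poly" where
  "gegenbauer \<gamma> 0 = 1"
| "gegenbauer \<gamma> (Suc 0) = [:0, 1:]"
| "gegenbauer \<gamma> (Suc (Suc 0)) = [:- 1 / 2, 0, \<gamma> + 1:]"
| "gegenbauer \<gamma> (Suc (Suc (Suc n))) =
     smult (1 / (real n + 3))
       (smult (2 * (real n + 2 + \<gamma>)) ([:0, 1:] * gegenbauer \<gamma> (Suc (Suc n)))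
        - smult (real n + 1 + 2 * \<gamma>) (gegenbauer \<gamma> (Suc n)))"

lemma gegenbauer_recurrence:
  assumes "n \<ge> 2"
  shows "smult (real n + 1) (gegenbauer \<gamma> (n + 1)) =
    smult (2 * (real n + \<gamma>)) ([:0, 1:] * gegenbauer \<gamma> n)
    - smult (real n - 1 + 2 * \<gamma>) (gegenbauer \<gamma> (n - 1))"
proof -
  obtain m where "n = Suc (Suc m)"
    using assms by (metis Suc_le_D numeral_2_eq_2 Suc_le_mono)
  then show ?thesis by (simp add: algebra_simps)
qed

definition gegenbauer_tau_eigenvalue :: "real \<Rightarrow> nat \<Rightarrow> complex \<Rightarrow> bool" where
  "gegenbauer_tau_eigenvalue \<gamma> n lam \<longleftrightarrow>
    (\<exists>u :: complex poly. u \<noteq> 0 \<and> degree u \<le> n \<and>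
       (\<forall>x. poly u (- x) = (if even n then poly u x else - poly u x)) \<and>
       poly u 1 = 0 \<and> poly u (- 1) = 0 \<and>
       (\<forall>p :: complex poly. degree p \<le> n - 2 \<longrightarrow>
          ((\<lambda>x :: real. (lam * poly u (of_real x) - poly (pderiv (pderiv u)) (of_real x))
                * poly p (of_real x) * of_real ((1 - x\<^sup>2) powr (\<gamma> - 1 / 2)))
             has_integral 0) {-1..1}))"

definition gegenbauer_tau_charpoly :: "real \<Rightarrow> nat \<Rightarrow> real poly" where
  "gegenbauer_tau_charpoly \<gamma> n =
    (\<Sum>k = 0..n div 2. monom (poly ((pderiv ^^ (2 * k)) (gegenbauer \<gamma> n)) 1) k)"

text \<open>
  \<open>\<mu>\<close> lists the zeros of a polynomial in increasing order, starting from index 1.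
  There are as many real zeros as the degree, so all complex zeros are real and simple.
\<close>

definition real_distinct_zeros :: "real poly \<Rightarrow> (nat \<Rightarrow> real) \<Rightarrow> bool" where
  "real_distinct_zeros p \<mu> \<longleftrightarrow> p \<noteq> 0 \<and> strict_mono_on {1..degree p} \<mu> \<and>
     {x. poly p x = 0} = \<mu> ` {1..degree p}"

text \<open>
  The relation is not symmetric, and it includes negativity of the zeros: in the case of equal
  degrees the smallest zero belongs to the second polynomial.
\<close>

definition strictly_interlace :: "real poly \<Rightarrow> real poly \<Rightarrow> bool" where
  "strictly_interlace p q \<longleftrightarrow>
    (\<exists>\<mu> \<mu>'. real_distinct_zeros p \<mu> \<and> real_distinct_zeros q \<mu>' \<and>
       (\<forall>i\<in>{1..degree p}. \<mu> i < 0) \<and>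
       (degree p = degree q + 1 \<and>
          (\<forall>i\<in>{1..degree q}. \<mu> i < \<mu>' i \<and> \<mu>' i < \<mu> (i + 1))
        \<or> degree q = degree p \<and>
          (\<forall>i\<in>{1..degree p}. \<mu>' i < \<mu> i) \<and>
          (\<forall>i\<in>{1..<degree p}. \<mu> i < \<mu>' (i + 1))))"

end

theory Submission
  imports Defs
begin

text \<open>
  Let \<open>u\<^sub>n\<close> solve \<open>u\<^sub>n - \<mu> u\<^sub>n'' = G\<^sub>n\<close>, so that \<open>\<Omega>\<^sub>n(\<mu>) = u\<^sub>n(1)\<close>, and let \<open>O\<^sub>n(\<mu>) = u\<^sub>n'(1)\<close>. Since
  \<open>G\<^sub>n'\<close> is a positive multiple of the Gegenbauer polynomial of degree \<open>n - 1\<close> and index \<open>\<gamma> + 1\<close>, \<open>O\<^sub>n\<close> is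
  up to a positive factor the characteristic polynomial of degree \<open>n - 1\<close> and index \<open>\<gamma> + 1\<close>.
  For \<open>\<gamma> \<le> 3/2\<close> and \<open>\<mu> < 0\<close> an integral identity excludes that a nontrivial combination of \<open>u\<^sub>n\<close> and
  \<open>u\<^sub>n\<^sub>-\<^sub>1\<close> vanishes at 1 together with its derivative, so that
  \<open>W = O\<^sub>n \<Omega>\<^sub>n\<^sub>-\<^sub>1 - \<Omega>\<^sub>n O\<^sub>n\<^sub>-\<^sub>1\<close> does not vanish for \<open>\<mu> < 0\<close>; it is positive at 0, hence for all \<open>\<mu> \<le> 0\<close>.
  The sign of \<open>W\<close> at the zeros of \<open>\<Omega>\<^sub>n\<^sub>-\<^sub>1\<close> and then of \<open>\<Omega>\<^sub>n\<close> shows by induction on \<open>n\<close> that \<open>\<Omega>\<^sub>n\<close> has only simple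
  negative zeros, that they interlace with those of \<open>\<Omega>\<^sub>n\<^sub>-\<^sub>1\<close>, and that \<open>O\<^sub>n\<close> alternates in sign along them;
  in the same way \<open>O\<^sub>n\<close> and \<open>O\<^sub>n\<^sub>-\<^sub>1\<close> interlace. The latter is the range \<open>1/2 < \<gamma> \<le> 5/2\<close> of the theorem.
\<close>

section \<open>Gegenbauer polynomials\<close>

lemma gegenbauer_recurrence_poly:
  assumes "m \<ge> 1"
  shows "(real m + 2) * poly (gegenbauer \<gamma> (Suc (Suc m))) x =
    2 * (real m + 1 + \<gamma>) * x * poly (gegenbauer \<gamma> (Suc m)) x
    - (real m + 2 * \<gamma>) * poly (gegenbauer \<gamma> m) x"
proof -
  obtain k where "m = Suc k" using assms by (cases m) auto
  then show ?thesis by (simp add: field_simps)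
qed

lemma gegenbauer_recurrence_pderiv:
  assumes "m \<ge> 1"
  shows "(real m + 2) * poly (pderiv (gegenbauer \<gamma> (Suc (Suc m)))) x =
    2 * (real m + 1 + \<gamma>) *
      (poly (gegenbauer \<gamma> (Suc m)) x + x * poly (pderiv (gegenbauer \<gamma> (Suc m))) x)
    - (real m + 2 * \<gamma>) * poly (pderiv (gegenbauer \<gamma> m)) x"
proof -
  obtain k where "m = Suc k" using assms by (cases m) auto
  then show ?thesis
    by (simp add: pderiv_smult pderiv_diff pderiv_mult pderiv_pCons field_simps)
qed

text \<open>The induction needs both identities at once: the first in a new degree comes from the
  recurrence and both identities in lower degrees, the second from the differentiated recurrence and
  the first. The index starts at 1 because \<open>G_0 = 1\<close> does not follow the normalization
  of the other degrees.\<close>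

lemma gegenbauer_pderiv_backward_forward:
  "real (Suc m) * poly (gegenbauer \<gamma> (Suc m)) x =
     x * poly (pderiv (gegenbauer \<gamma> (Suc m))) x - poly (pderiv (gegenbauer \<gamma> m)) x \<and>
   poly (pderiv (gegenbauer \<gamma> (Suc (Suc m)))) x =
     x * poly (pderiv (gegenbauer \<gamma> (Suc m))) x
     + (real (Suc m) + 2 * \<gamma>) * poly (gegenbauer \<gamma> (Suc m)) x"
proof (induction m rule: less_induct)
  case (less m)
  consider "m = 0" | "m = 1" | k where "m = Suc (Suc k)"
    by (metis One_nat_def not0_implies_Suc)
  then show ?case
  proof cases
    case 1
    then show ?thesis by (simp add: pderiv_pCons field_simps)
  next
    case 2
    then show ?thesis
      using gegenbauer_recurrence_pderiv[of 1 \<gamma> x]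
      by (simp add: pderiv_pCons pderiv_smult pderiv_diff pderiv_mult field_simps)
  next
    case 3
    let ?g = "\<lambda>i. poly (gegenbauer \<gamma> i) x" and ?d = "\<lambda>i. poly (pderiv (gegenbauer \<gamma> i)) x"
    have k1: "real (k + 2) * ?g (k + 2) = x * ?d (k + 2) - ?d (k + 1)"
      and k2: "?d (k + 3) = x * ?d (k + 2) + (real (k + 2) + 2 * \<gamma>) * ?g (k + 2)"
      using less.IH[of "Suc k"] 3 by (auto simp: numeral_eq_Suc)
    have k3: "?d (k + 2) = x * ?d (k + 1) + (real (k + 1) + 2 * \<gamma>) * ?g (k + 1)"
      using less.IH[of k] 3 by (auto simp: numeral_eq_Suc)
    have r: "real (k + 3) * ?g (k + 3) =
        2 * (real (k + 2) + \<gamma>) * x * ?g (k + 2) - (real (k + 1) + 2 * \<gamma>) * ?g (k + 1)"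
      using gegenbauer_recurrence_poly[of "Suc k" \<gamma> x] by (simp add: numeral_eq_Suc algebra_simps)
    have rd: "real (k + 4) * ?d (k + 4) = 2 * (real (k + 3) + \<gamma>) * (?g (k + 3) + x * ?d (k + 3))
        - (real (k + 2) + 2 * \<gamma>) * ?d (k + 2)"
      using gegenbauer_recurrence_pderiv[of "Suc (Suc k)" \<gamma> x]
      by (simp add: numeral_eq_Suc algebra_simps)
    have b: "real (k + 3) * ?g (k + 3) = x * ?d (k + 3) - ?d (k + 2)"
      using k1 k2 k3 r by (simp add: algebra_simps) algebra
    have "real (k + 4) * ?d (k + 4) = real (k + 4) *
        (x * ?d (k + 3) + (real (k + 3) + 2 * \<gamma>) * ?g (k + 3))"
      using rd b by (simp add: algebra_simps) algebra
    then have "?d (k + 4) = x * ?d (k + 3) + (real (k + 3) + 2 * \<gamma>) * ?g (k + 3)"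
      by simp
    with b 3 show ?thesis by (simp add: numeral_eq_Suc)
  qed
qed

lemmas gegenbauer_pderiv_backward = gegenbauer_pderiv_backward_forward[THEN conjunct1]
  and gegenbauer_pderiv_forward = gegenbauer_pderiv_backward_forward[THEN conjunct2]

text \<open>The derivative identities combine to
  \<open>(1 - x^2) G_n' = (n - 1 + 2 \<gamma>) G_(n-1) - n x G_n\<close>; differentiating this and
  eliminating \<open>G_(n-1)'\<close> gives the equation.\<close>

lemma gegenbauer_ode:
  "(1 - x\<^sup>2) * poly (pderiv (pderiv (gegenbauer \<gamma> n))) x
     - (2 * \<gamma> + 1) * x * poly (pderiv (gegenbauer \<gamma> n)) x
     + real n * (real n + 2 * \<gamma>) * poly (gegenbauer \<gamma> n) x = 0"
proof -
  consider "n = 0" | "n = 1" | m where "n = Suc (Suc m)"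
    by (metis One_nat_def not0_implies_Suc)
  then show ?thesis
  proof cases
    case 3
    let ?g = "gegenbauer \<gamma>"
    have "[:1, 0, -1:] * pderiv (?g n) =
      smult (real (Suc m) + 2 * \<gamma>) (?g (Suc m)) - smult (real n) ([:0, 1:] * ?g n)"
    proof (rule poly_ext)
      fix x
      show "poly ([:1, 0, -1:] * pderiv (?g n)) x = poly (smult (real (Suc m) + 2 * \<gamma>)
        (?g (Suc m)) - smult (real n) ([:0, 1:] * ?g n)) x"
        using gegenbauer_pderiv_backward[of "Suc m" \<gamma> x] gegenbauer_pderiv_forward[of \<gamma> m x]
        unfolding 3 by (simp add: algebra_simps) algebra
    qed
    then have "poly (pderiv ([:1, 0, -1:] * pderiv (?g n))) x = poly (pderiv
       (smult (real (Suc m) + 2 * \<gamma>) (?g (Suc m)) - smult (real n) ([:0, 1:] * ?g n))) x"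
      by simp
    then have "(1 - x\<^sup>2) * poly (pderiv (pderiv (?g n))) x - 2 * x * poly (pderiv (?g n)) x =
       (real n - 1 + 2 * \<gamma>) * poly (pderiv (?g (Suc m))) x
        - real n * (poly (?g n) x + x * poly (pderiv (?g n)) x)"
      unfolding 3 by (simp del: gegenbauer.simps add: pderiv_mult pderiv_pCons pderiv_diff pderiv_smult pderiv_add pderiv_minus
          power2_eq_square algebra_simps)
    moreover have "real n * poly (?g n) x = x * poly (pderiv (?g n)) x - poly (pderiv (?g (Suc m))) x"
      using gegenbauer_pderiv_backward[of "Suc m" \<gamma> x] unfolding 3 by simp
    ultimately show ?thesis by algebra
  qed (simp_all add: pderiv_pCons algebra_simps)
qed

text \<open>Eliminating the undifferentiated polynomial between the two derivative identities leaves
  a three-term recurrence for the derivatives, which is the one of index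
  \<open>\<gamma> + 1\<close>. Degree 1 is left out since \<open>G_1' = 1\<close> lacks the
  factor.\<close>

lemma pderiv_gegenbauer:
  "pderiv (gegenbauer \<gamma> (Suc (Suc m))) = smult (2 * (\<gamma> + 1)) (gegenbauer (\<gamma> + 1) (Suc m))"
proof (induction m rule: less_induct)
  case (less m)
  consider "m = 0" | "m = 1" | k where "m = Suc (Suc k)"
    by (metis One_nat_def not0_implies_Suc)
  then show ?case
  proof cases
    case 1
    then show ?thesis by (simp add: pderiv_pCons)
  next
    case 2
    then show ?thesis 
      by (simp add: pderiv_pCons pderiv_smult pderiv_diff pderiv_mult field_simps)
  next
    case 3
    show ?thesis
    proof (rule poly_ext)
      fix x
      let ?h = "\<lambda>i. poly (gegenbauer (\<gamma> + 1) i) x"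
      let ?g = "\<lambda>i. poly (gegenbauer \<gamma> i) x" and ?d = "\<lambda>i. poly (pderiv (gegenbauer \<gamma> i)) x"
      have h1: "?d (k + 3) = 2 * (\<gamma> + 1) * ?h (k + 2)" and h2: "?d (k + 2) = 2 * (\<gamma> + 1) * ?h (k + 1)"
        using less.IH[of k] less.IH[of "Suc k"] 3 by (auto simp del: gegenbauer.simps simp: numeral_eq_Suc)
      have b: "real (k + 3) * ?g (k + 3) = x * ?d (k + 3) - ?d (k + 2)"
        and f: "?d (k + 4) = x * ?d (k + 3) + (real (k + 3) + 2 * \<gamma>) * ?g (k + 3)"
        using gegenbauer_pderiv_backward_forward[of "k+2" \<gamma> x] by (auto simp: numeral_eq_Suc)
      have r: "real (k + 3) * ?h (k + 3) =
          2 * (real (k + 3) + \<gamma>) * x * ?h (k + 2) - (real (k + 3) + 2 * \<gamma>) * ?h (k + 1)"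
        using gegenbauer_recurrence_poly[of "Suc k" "\<gamma> + 1" x] by (simp add: numeral_eq_Suc algebra_simps)
      have "real (k + 3) * ?d (k + 4) = real (k + 3) * x * ?d (k + 3) 
         + (real (k + 3) + 2 * \<gamma>) * (x * ?d (k + 3) - ?d (k + 2))"
        unfolding f b[symmetric] by (simp only: algebra_simps)
      also have "\<dots> = 2 * (\<gamma> + 1) * (2 * (real (k + 3) + \<gamma>) * x * ?h (k + 2)
         - (real (k + 3) + 2 * \<gamma>) * ?h (k + 1))"
        unfolding h1 h2 by (simp only: algebra_simps)
      also have "\<dots> = real (k + 3) * (2 * (\<gamma> + 1) * ?h (k + 3))"
        unfolding r[symmetric] by (simp only: algebra_simps)
      finally have "?d (k + 4) = 2 * (\<gamma> + 1) * ?h (k + 3)" by simp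
      then show "?d (Suc (Suc m)) = poly (smult (2 * (\<gamma> + 1)) (gegenbauer (\<gamma> + 1) (Suc m))) x"
        using 3 by (simp del: gegenbauer.simps add: numeral_eq_Suc)
    qed
  qed
qed

section \<open>Parity, leading coefficients and derivatives at 1\<close>

lemma gegenbauer_parity:
  "poly (gegenbauer \<gamma> n) (- x) = (- 1) ^ n * poly (gegenbauer \<gamma> n) x"
  by (induction \<gamma> n rule: gegenbauer.induct) (simp_all add: field_simps)

lemma degree_gegenbauer_le: "degree (gegenbauer \<gamma> n) \<le> n"
proof (induction \<gamma> n rule: gegenbauer.induct)
  case (4 \<gamma> n)
  then show ?case
    by (auto intro!: degree_diff_le order.trans[OF degree_smult_le] degree_pCons_le
        order.trans[OF degree_pCons_le] simp: degree_smult_le)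
qed (auto intro: degree_pCons_le simp: degree_pCons_eq_if)

lemma coeff_gegenbauer_pos:
  assumes "\<gamma> > - 1 / 2"
  shows "coeff (gegenbauer \<gamma> n) n > 0"
  using assms
proof (induction \<gamma> n rule: gegenbauer.induct)
  case (4 \<gamma> n)
  have "coeff (gegenbauer \<gamma> (Suc n)) (Suc (Suc (Suc n))) = 0"
    using degree_gegenbauer_le[of \<gamma> "Suc n"] by (intro coeff_eq_0) auto
  with 4 show ?case by (simp add: coeff_pCons)
qed (auto simp: numeral_eq_Suc)

text \<open>At \<open>x = 1\<close> the derivative identities leave
  \<open>(m + 2) G_(m+2)(1) = (m + 1 + 2 \<gamma>) G_(m+1)(1)\<close>, with positive
  factors.\<close>

lemma gegenbauer_at_1_pos:
  assumes "\<gamma> > - 1 / 2"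
  shows "poly (gegenbauer \<gamma> n) 1 > 0"
proof -
  have "poly (gegenbauer \<gamma> (Suc m)) 1 > 0" for m
  proof (induction m)
    case (Suc m)
    have "(real m + 2) * poly (gegenbauer \<gamma> (Suc (Suc m))) 1 =
        (real m + 1 + 2 * \<gamma>) * poly (gegenbauer \<gamma> (Suc m)) 1"
      using gegenbauer_pderiv_backward[of "Suc m" \<gamma> 1] gegenbauer_pderiv_forward[of \<gamma> m 1]
      by (simp add: algebra_simps)
    moreover have "(real m + 1 + 2 * \<gamma>) * poly (gegenbauer \<gamma> (Suc m)) 1 > 0"
      using Suc assms by (intro mult_pos_pos) auto
    ultimately show ?case
      using zero_less_mult_pos[of "real m + 2"] by (metis add_nonneg_pos of_nat_0_le_iff zero_less_numeral)
  qed simp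
  then show ?thesis by (cases n) auto
qed

text \<open>Each derivative trades one degree for one unit of index, up to a positive factor, until
  only a value at 1 is left. For even \<open>k\<close> these numbers are the coefficients of the
  characteristic polynomial.\<close>

lemma higher_pderiv_gegenbauer_at_1_pos:
  assumes "\<gamma> > - 1 / 2" "k \<le> n"
  shows "poly ((pderiv ^^ k) (gegenbauer \<gamma> n)) 1 > 0"
  using assms
proof (induction k arbitrary: \<gamma> n)
  case 0
  then show ?case by (simp add: gegenbauer_at_1_pos)
next
  case (Suc k)
  then obtain m where n: "n = Suc m" by (cases n) auto
  show ?case
  proof (cases m)
    case 0
    then show ?thesis using Suc n by (auto simp: pderiv_pCons)
  next
    case (Suc l)
    then have "(pderiv ^^ Suc k) (gegenbauer \<gamma> n) = smult (2 * (\<gamma> + 1)) ((pderiv ^^ k) (gegenbauer (\<gamma> + 1) m))"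
      by (simp del: gegenbauer.simps funpow.simps
          add: n funpow_Suc_right pderiv_gegenbauer higher_pderiv_smult)
    moreover have "poly ((pderiv ^^ k) (gegenbauer (\<gamma> + 1) m)) 1 > 0"
      using Suc.prems n by (intro Suc.IH) auto
    ultimately show ?thesis using Suc.prems by simp
  qed
qed

section \<open>Orthogonality\<close>

definition gegenbauer_weight :: "real \<Rightarrow> real \<Rightarrow> real" where
  "gegenbauer_weight \<gamma> x = (1 - x\<^sup>2) powr (\<gamma> - 1 / 2)"

definition gegenbauer_integral :: "real \<Rightarrow> real poly \<Rightarrow> real" where
  "gegenbauer_integral \<gamma> p = integral {-1..1} (\<lambda>x. poly p x * gegenbauer_weight \<gamma> x)"

lemma gegenbauer_weight_nonneg [simp]: "gegenbauer_weight \<gamma> x \<ge> 0"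
  by (simp add: gegenbauer_weight_def)

text \<open>The substitution \<open>x = 2 t - 1\<close> leads, up to a constant, to the Beta
  integral with both parameters \<open>\<gamma> + 1/2\<close>.\<close>

lemma gegenbauer_weight_integrable:
  assumes "\<gamma> > - 1 / 2"
  shows "gegenbauer_weight \<gamma> integrable_on {-1..1}"
proof -
  let ?e = "\<gamma> - 1 / 2"
  have "((\<lambda>t. t powr (\<gamma> + 1 / 2 - 1) * (1 - t) powr (\<gamma> + 1 / 2 - 1)) has_integral
      Beta (\<gamma> + 1 / 2) (\<gamma> + 1 / 2)) (cbox 0 1)"
    using has_integral_Beta_real[of "\<gamma> + 1 / 2" "\<gamma> + 1 / 2"] assms by simp
  from has_integral_affinity'[OF this, of "1 / 2" "1 / 2"]
  have "(\<lambda>x. ((x + 1) / 2) powr ?e * ((1 - x) / 2) powr ?e) integrable_on {-1..1}"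
    by (auto simp: field_simps has_integral_iff)
  then have "(\<lambda>x. 4 powr ?e * (((x + 1) / 2) powr ?e * ((1 - x) / 2) powr ?e)) integrable_on {-1..1}"
    by (rule integrable_on_mult_right)
  moreover have "4 powr ?e * (((x + 1) / 2) powr ?e * ((1 - x) / 2) powr ?e) = gegenbauer_weight \<gamma> x"
    if "x \<in> {-1..1}" for x
  proof -
    have eq: "1 - x\<^sup>2 = 4 * ((x + 1) / 2 * ((1 - x) / 2))" by (simp add: power2_eq_square field_simps)
    have "gegenbauer_weight \<gamma> x = (4 * ((x + 1) / 2 * ((1 - x) / 2))) powr ?e"
      unfolding gegenbauer_weight_def eq ..
    also have "\<dots> = 4 powr ?e * ((x + 1) / 2 * ((1 - x) / 2)) powr ?e"
      by (rule powr_mult)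
    also have "((x + 1) / 2 * ((1 - x) / 2)) powr ?e = ((x + 1) / 2) powr ?e * ((1 - x) / 2) powr ?e"
      by (rule powr_mult)
    finally show ?thesis by simp
  qed
  ultimately show ?thesis by (rule integrable_eq)
qed

lemma gegenbauer_poly_integrable:
  assumes "\<gamma> > - 1 / 2"
  shows "(\<lambda>x. poly p x * gegenbauer_weight \<gamma> x) integrable_on {-1..1}"
proof -
  have "gegenbauer_weight \<gamma> absolutely_integrable_on {-1..1}"
    using gegenbauer_weight_integrable[OF assms] by (intro nonnegative_absolutely_integrable_1) auto
  moreover have "bounded (poly p ` {-1..1})"
    by (intro compact_imp_bounded compact_continuous_image continuous_intros) auto
  moreover have "poly p \<in> borel_measurable (lebesgue_on {-1..1})"
    by (intro continuous_imp_measurable_on_sets_lebesgue continuous_intros) auto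
  ultimately have "(\<lambda>x. poly p x * gegenbauer_weight \<gamma> x) absolutely_integrable_on {-1..1}"
    by (intro absolutely_integrable_bounded_measurable_product_real) auto
  then show ?thesis by (rule set_lebesgue_integral_eq_integral)
qed

lemma has_integral_gegenbauer_integral:
  assumes "\<gamma> > - 1 / 2"
  shows "((\<lambda>x. poly p x * gegenbauer_weight \<gamma> x) has_integral gegenbauer_integral \<gamma> p) {-1..1}"
  using gegenbauer_poly_integrable[OF assms] by (simp add: gegenbauer_integral_def integrable_integral)

lemma gegenbauer_integral_eqI:
  assumes "\<gamma> > - 1 / 2" and "((\<lambda>x. poly p x * gegenbauer_weight \<gamma> x) has_integral I) {-1..1}"
  shows "gegenbauer_integral \<gamma> p = I"
  using assms by (simp add: gegenbauer_integral_def integral_unique)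

lemma gegenbauer_integral_linear:
  assumes "\<gamma> > - 1 / 2"
  shows gegenbauer_integral_add:
      "gegenbauer_integral \<gamma> (p + q) = gegenbauer_integral \<gamma> p + gegenbauer_integral \<gamma> q"
    and gegenbauer_integral_smult: "gegenbauer_integral \<gamma> (smult c p) = c * gegenbauer_integral \<gamma> p"
proof -
  note I = has_integral_gegenbauer_integral[OF assms]
  show "gegenbauer_integral \<gamma> (p + q) = gegenbauer_integral \<gamma> p + gegenbauer_integral \<gamma> q"
    using has_integral_add[OF I[of p] I[of q]]
    by (intro gegenbauer_integral_eqI[OF assms]) (simp add: algebra_simps)
  show "gegenbauer_integral \<gamma> (smult c p) = c * gegenbauer_integral \<gamma> p"
    using has_integral_mult_right[OF I[of p], of c]
    by (intro gegenbauer_integral_eqI[OF assms]) (simp add: algebra_simps)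
qed

lemma gegenbauer_integral_diff:
  assumes "\<gamma> > - 1 / 2"
  shows "gegenbauer_integral \<gamma> (p - q) = gegenbauer_integral \<gamma> p - gegenbauer_integral \<gamma> q"
  using gegenbauer_integral_add[OF assms, of p "smult (- 1) q"]
    gegenbauer_integral_smult[OF assms, of "- 1" q] by simp

lemma gegenbauer_integral_0 [simp]: "gegenbauer_integral \<gamma> 0 = 0"
  by (simp add: gegenbauer_integral_def)

lemma gegenbauer_integral_nonneg:
  assumes "\<gamma> > - 1 / 2" and "\<And>x. x \<in> {-1..1} \<Longrightarrow> poly p x \<ge> 0"
  shows "gegenbauer_integral \<gamma> p \<ge> 0"
  using has_integral_nonneg[OF has_integral_gegenbauer_integral[OF assms(1)]] assms(2) by simp

text \<open>The weight may be singular at the endpoints, so the argument for continuous integrands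
  is applied on \<open>{-r..r}\<close> with \<open>r < 1\<close>. A general \<open>f\<close> is
  allowed in order to cover the squared modulus of a complex polynomial.\<close>

lemma gegenbauer_weighted_integral_eq_0D:
  fixes f :: "real \<Rightarrow> real"
  assumes "continuous_on UNIV f" "\<And>x. f x \<ge> 0"
    and int: "((\<lambda>x. f x * gegenbauer_weight \<gamma> x) has_integral 0) {-1..1}"
    and x: "x \<in> {-1<..<1}"
  shows "f x = 0"
proof -
  obtain r where "\<bar>x\<bar> < r" "r < 1" using x dense[of "\<bar>x\<bar>" 1] by (auto simp: abs_less_iff)
  then have r: "0 < r" "r < 1" "x \<in> {-r..r}" "{-r..r} \<subseteq> {-1..1}"
    by auto
  let ?f = "\<lambda>x. f x * gegenbauer_weight \<gamma> x"
  have pos: "1 - t\<^sup>2 > 0" if "t \<in> {-r..r}" for t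
  proof -
    have "\<bar>t\<bar> < 1" using that r(2) by (simp add: abs_less_iff)
    then show ?thesis by (simp add: abs_square_less_1)
  qed
  have i: "?f integrable_on {-r..r}"
    using has_integral_integrable[OF int] r(4) by (rule integrable_on_subinterval)
  have "integral {-r..r} ?f \<le> integral {-1..1} ?f"
    using integral_subset_le[OF r(4) i has_integral_integrable[OF int]] assms(2) by simp
  also have "\<dots> = 0" using int by (rule integral_unique)
  finally have "integral {-r..r} ?f = 0"
    using integral_nonneg[OF i] assms(2) by simp
  then have h0: "(?f has_integral 0) (cbox (-r) r)" using i by (auto simp: has_integral_iff)
  have "continuous_on (cbox (-r) r) ?f"
    unfolding gegenbauer_weight_def
    using pos by (intro continuous_intros continuous_on_subset[OF assms(1)]) fastforce+
  from has_integral_0_cbox_imp_0[OF this _ h0] have "?f x = 0"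
    using assms(2) r by auto
  moreover have "gegenbauer_weight \<gamma> x \<noteq> 0" using pos[OF r(3)] by (simp add: gegenbauer_weight_def)
  ultimately show ?thesis by simp
qed

lemma gegenbauer_integral_square_pos:
  assumes "\<gamma> > - 1 / 2" "p \<noteq> 0"
  shows "gegenbauer_integral \<gamma> (p * p) > 0"
proof (rule ccontr)
  assume "\<not> ?thesis"
  then have "gegenbauer_integral \<gamma> (p * p) = 0"
    using gegenbauer_integral_nonneg[OF assms(1), of "p * p"] by simp
  then have "((\<lambda>x. poly (p * p) x * gegenbauer_weight \<gamma> x) has_integral 0) {-1..1}"
    using has_integral_gegenbauer_integral[OF assms(1), of "p * p"] by simp
  then have "poly (p * p) x = 0" if "x \<in> {-1<..<1}" for x
    using that by (intro gegenbauer_weighted_integral_eq_0D[of "poly (p * p)"]) (auto intro!: continuous_intros)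
  then have "{-1<..<1} \<subseteq> {x. poly p x = 0}" by auto
  moreover have "infinite {-1<..<1::real}" by (simp add: infinite_Ioo)
  ultimately show False using poly_roots_finite[OF assms(2)] finite_subset by blast
qed

text \<open>Both boundary terms vanish because the exponent \<open>\<gamma> + 1/2\<close> is positive.\<close>

lemma gegenbauer_integral_by_parts:
  assumes "\<gamma> > - 1 / 2"
  shows "gegenbauer_integral \<gamma> ([:1, 0, -1:] * pderiv p - [:0, 2 * \<gamma> + 1:] * p) = 0"
proof (rule gegenbauer_integral_eqI[OF assms])
  let ?F = "\<lambda>x. (1 - x\<^sup>2) powr (\<gamma> + 1 / 2) * poly p x"
  let ?f = "\<lambda>x. poly ([:1, 0, -1:] * pderiv p - [:0, 2 * \<gamma> + 1:] * p) x * gegenbauer_weight \<gamma> x"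
  have "(?f has_integral (?F 1 - ?F (-1))) {-1..1}"
  proof (rule fundamental_theorem_of_calculus_interior)
    have "1 - x\<^sup>2 \<ge> 0" if "x \<in> {-1..1}" for x :: real
      using that abs_square_le_1[of x] by auto
    then show "continuous_on {-1..1} ?F"
      using assms by (intro continuous_intros continuous_on_powr') auto
    fix x :: real assume "x \<in> {-1<..<1}"
    then have pos: "1 - x\<^sup>2 > 0" using abs_square_less_1[of x] by auto
    have "(?F has_real_derivative (1 - x\<^sup>2) powr (\<gamma> + 1 / 2) * poly (pderiv p) x +
        (\<gamma> + 1 / 2) * (1 - x\<^sup>2) powr (\<gamma> + 1 / 2 - 1) * (- 2 * x) * poly p x) (at x)"
      using pos by (auto intro!: derivative_eq_intros)
    moreover have E: "(1 - x\<^sup>2) powr (\<gamma> + 1 / 2) = (1 - x\<^sup>2) * (1 - x\<^sup>2) powr (\<gamma> - 1 / 2)"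
      using pos powr_add[of "1 - x\<^sup>2" 1 "\<gamma> - 1 / 2"] by (simp add: add.commute)
    moreover have "(1 - x\<^sup>2) powr (\<gamma> + 1 / 2) * poly (pderiv p) x +
        (\<gamma> + 1 / 2) * (1 - x\<^sup>2) powr (\<gamma> + 1 / 2 - 1) * (- 2 * x) * poly p x = ?f x"
      unfolding E gegenbauer_weight_def by (simp add: power2_eq_square algebra_simps)
    ultimately have "(?F has_real_derivative ?f x) (at x)" by simp
    then show "(?F has_vector_derivative ?f x) (at x)"
      by (simp add: has_real_derivative_iff_has_vector_derivative)
  qed simp
  then show "(?f has_integral 0) {-1..1}" by simp
qed

text \<open>By the differential equation the two integrands differ by the integration-by-parts
  expression of \<open>G_n' p\<close>, whose integral is zero.\<close>

lemma gegenbauer_dirichlet_form: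
  assumes "\<gamma> > - 1 / 2"
  shows "gegenbauer_integral \<gamma> ([:1, 0, -1:] * pderiv (gegenbauer \<gamma> n) * pderiv p) =
    real n * (real n + 2 * \<gamma>) * gegenbauer_integral \<gamma> (gegenbauer \<gamma> n * p)"
proof -
  let ?G = "gegenbauer \<gamma> n"
  have "[:1, 0, -1:] * pderiv ?G * pderiv p =
     ([:1, 0, -1:] * pderiv (pderiv ?G * p) - [:0, 2 * \<gamma> + 1:] * (pderiv ?G * p))
     + smult (real n * (real n + 2 * \<gamma>)) (?G * p)"
  proof (rule poly_ext)
    fix x
    have "poly p x * ((1 - x\<^sup>2) * poly (pderiv (pderiv ?G)) x - (2 * \<gamma> + 1) * x * poly (pderiv ?G) x
        + real n * (real n + 2 * \<gamma>) * poly ?G x) = 0"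
      by (simp only: gegenbauer_ode)
    moreover have "poly (pderiv (pderiv ?G * p)) x =
        poly (pderiv (pderiv ?G)) x * poly p x + poly (pderiv ?G) x * poly (pderiv p) x"
      by (simp add: pderiv_mult)
    ultimately show "poly ([:1, 0, -1:] * pderiv ?G * pderiv p) x =
       poly (([:1, 0, -1:] * pderiv (pderiv ?G * p) - [:0, 2 * \<gamma> + 1:] * (pderiv ?G * p))
       + smult (real n * (real n + 2 * \<gamma>)) (?G * p)) x"
      by (simp add: power2_eq_square algebra_simps del: gegenbauer.simps)
  qed
  then show ?thesis
    by (simp only: gegenbauer_integral_add[OF assms] gegenbauer_integral_smult[OF assms]
        gegenbauer_integral_by_parts[OF assms] add_0_left)
qed

text \<open>The Dirichlet form is symmetric, and \<open>n (n + 2 \<gamma>)\<close> and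
  \<open>m (m + 2 \<gamma>)\<close> differ by \<open>(n - m) (n + m + 2 \<gamma>)\<close>, which is
  nonzero as \<open>n + m\<close> is at least 1.\<close>

lemma gegenbauer_integral_gegenbauer_mult:
  assumes "\<gamma> > - 1 / 2" "m < n"
  shows "gegenbauer_integral \<gamma> (gegenbauer \<gamma> n * gegenbauer \<gamma> m) = 0"
proof -
  let ?I = "gegenbauer_integral \<gamma> (gegenbauer \<gamma> n * gegenbauer \<gamma> m)"
  have "real n * (real n + 2 * \<gamma>) * ?I = real m * (real m + 2 * \<gamma>) * ?I"
    using gegenbauer_dirichlet_form[OF assms(1), of n "gegenbauer \<gamma> m"]
      gegenbauer_dirichlet_form[OF assms(1), of m "gegenbauer \<gamma> n"]
    by (simp only: mult.assoc mult.commute mult.left_commute)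
  then have "(real n - real m) * (real n + real m + 2 * \<gamma>) * ?I = 0"
    by (simp add: algebra_simps)
  moreover have "real n \<ge> 1" using assms(2) by simp
  ultimately show ?thesis using assms by auto
qed

lemma gegenbauer_orthogonal:
  assumes "\<gamma> > - 1 / 2" "p = 0 \<or> degree p < n"
  shows "gegenbauer_integral \<gamma> (gegenbauer \<gamma> n * p) = 0"
  using assms(2)
proof (induction "degree p" arbitrary: p rule: less_induct)
  case less
  show ?case
  proof (cases "p = 0")
    case False
    define d where "d = degree p"
    have d: "d < n" using less.prems False by (simp add: d_def)
    \<comment> \<open>Subtracting this multiple of \<open>G_d\<close> cancels the leading term of
      \<open>p\<close>, so \<open>q\<close> falls under the induction hypothesis.\<close>
    define c where "c = coeff p d / coeff (gegenbauer \<gamma> d) d"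
    define q where "q = p - smult c (gegenbauer \<gamma> d)"
    have cd: "coeff q d = 0"
      using coeff_gegenbauer_pos[OF assms(1), of d] by (simp add: q_def c_def)
    have "degree q \<le> d" unfolding q_def
      using degree_gegenbauer_le[of \<gamma> d] by (intro degree_diff_le order.trans[OF degree_smult_le]) (auto simp: d_def)
    then have q: "q = 0 \<or> degree q < d" using cd
      by (metis le_neq_implies_less leading_coeff_0_iff)
    have "gegenbauer_integral \<gamma> (gegenbauer \<gamma> n * q) = 0"
      using less.hyps[of q] q d unfolding d_def[symmetric] by fastforce
    moreover have "gegenbauer \<gamma> n * p = gegenbauer \<gamma> n * q + smult c (gegenbauer \<gamma> n * gegenbauer \<gamma> d)"
      by (simp add: q_def algebra_simps)
    ultimately show ?thesis
      by (simp add: gegenbauer_integral_add[OF assms(1)] gegenbauer_integral_smult[OF assms(1)]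
          gegenbauer_integral_gegenbauer_mult[OF assms(1) d])
  qed simp
qed

section \<open>The equation \<open>u - \<mu> u'' = p\<close>\<close>

text \<open>The Neumann series of \<open>(1 - \<mu> D^2)^-1\<close> applied to \<open>p\<close>; all
  terms with \<open>2 * k > degree p\<close> vanish. The field is general to serve both real and
  complex polynomials.\<close>

definition tau_sol :: "'a \<Rightarrow> 'a poly \<Rightarrow> 'a::field_char_0 poly" where
  "tau_sol \<mu> p = (\<Sum>k\<le>degree p. smult (\<mu> ^ k) ((pderiv ^^ (2 * k)) p))"

lemma higher_pderiv_eq_0:
  fixes p :: "'a::field_char_0 poly"
  assumes "degree p < k"
  shows "(pderiv ^^ k) p = 0"
  using assms by (intro poly_eqI) (simp add: coeff_higher_pderiv coeff_eq_0)

lemma tau_sol_eq: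
  fixes p :: "'a::field_char_0 poly"
  assumes "degree p < 2 * Suc N"
  shows "tau_sol \<mu> p = (\<Sum>k\<le>N. smult (\<mu> ^ k) ((pderiv ^^ (2 * k)) p))"
proof -
  have "tau_sol \<mu> p = (\<Sum>k\<le>max N (degree p). smult (\<mu> ^ k) ((pderiv ^^ (2 * k)) p))"
    unfolding tau_sol_def by (intro sum.mono_neutral_left) (auto simp: higher_pderiv_eq_0)
  also have "\<dots> = (\<Sum>k\<le>N. smult (\<mu> ^ k) ((pderiv ^^ (2 * k)) p))"
    using assms by (intro sum.mono_neutral_right) (auto simp: higher_pderiv_eq_0)
  finally show ?thesis .
qed

lemma degree_tau_sol_le: "degree (tau_sol \<mu> p) \<le> degree p"
  unfolding tau_sol_def
  by (intro degree_sum_le order.trans[OF degree_smult_le]) (auto simp: degree_higher_pderiv)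

lemma smult_sum_right: "smult c (\<Sum>i\<in>S. f i) = (\<Sum>i\<in>S. smult c (f i))"
  by (induction S rule: infinite_finite_induct) (simp_all add: smult_add_right)

lemma tau_sol_ode:
  "tau_sol \<mu> p - smult \<mu> (pderiv (pderiv (tau_sol \<mu> p))) = p"
proof -
  let ?t = "\<lambda>k. smult (\<mu> ^ k) ((pderiv ^^ (2 * k)) p)"
  have "smult \<mu> (pderiv (pderiv (tau_sol \<mu> p))) = (\<Sum>k\<le>degree p. ?t (Suc k))"
    by (simp add: tau_sol_def higher_pderiv_sum[of 1, simplified] pderiv_smult smult_sum_right)
  then have "tau_sol \<mu> p - smult \<mu> (pderiv (pderiv (tau_sol \<mu> p))) = ?t 0 - ?t (Suc (degree p))"
    unfolding tau_sol_def
    by (simp only: sum_subtractf[symmetric]) (rule sum_telescope[of ?t])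
  then show ?thesis
    using higher_pderiv_eq_0[of p "2 * Suc (degree p)"] by simp
qed

text \<open>The operator \<open>\<mu> D^2\<close> strictly lowers the degree of nonconstant
  polynomials and kills constants, so \<open>1 - \<mu> D^2\<close> is injective.\<close>

lemma smult_pderiv2_fixpoint_eq_0:
  fixes u :: "'a::field_char_0 poly"
  assumes "u = smult \<mu> (pderiv (pderiv u))"
  shows "u = 0"
proof (rule ccontr)
  assume "u \<noteq> 0"
  have "degree u \<le> degree u - 2"
    using assms degree_smult_le[of \<mu> "pderiv (pderiv u)"] by (simp add: degree_pderiv)
  then have "degree u = 0" by linarith
  then have "pderiv u = 0" by (simp add: pderiv_eq_0_iff)
  with assms \<open>u \<noteq> 0\<close> show False by simp
qed

lemma tau_sol_unique:
  assumes "u - smult \<mu> (pderiv (pderiv u)) = p"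
  shows "u = tau_sol \<mu> p"
proof -
  have "u - tau_sol \<mu> p = smult \<mu> (pderiv (pderiv (u - tau_sol \<mu> p)))"
  proof -
    have "smult \<mu> (pderiv (pderiv u)) = u - p" by (simp flip: assms)
    moreover have "smult \<mu> (pderiv (pderiv (tau_sol \<mu> p))) = tau_sol \<mu> p - p"
      by (subst (3) tau_sol_ode[of \<mu> p, symmetric]) simp
    ultimately show ?thesis by (simp add: pderiv_diff smult_diff_right)
  qed
  from smult_pderiv2_fixpoint_eq_0[OF this] show ?thesis by simp
qed

lemma tau_sol_add_smult:
  "tau_sol \<mu> (smult a p + smult b q) = smult a (tau_sol \<mu> p) + smult b (tau_sol \<mu> q)"
proof (rule tau_sol_unique[symmetric])
  let ?P = "tau_sol \<mu> p" and ?Q = "tau_sol \<mu> q"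
  have "smult a ?P + smult b ?Q - smult \<mu> (pderiv (pderiv (smult a ?P + smult b ?Q))) =
     smult a (?P - smult \<mu> (pderiv (pderiv ?P))) + smult b (?Q - smult \<mu> (pderiv (pderiv ?Q)))"
    by (simp add: pderiv_add pderiv_smult smult_add_right smult_diff_right mult.commute)
  then show "smult a ?P + smult b ?Q - smult \<mu> (pderiv (pderiv (smult a ?P + smult b ?Q))) =
      smult a p + smult b q"
    by (simp only: tau_sol_ode)
qed

lemma tau_sol_smult: "tau_sol \<mu> (smult a p) = smult a (tau_sol \<mu> p)"
  using tau_sol_add_smult[of \<mu> a p 0 0] by simp

text \<open>Differentiating the equation for \<open>p\<close> gives the equation for
  \<open>p'\<close>, whose solution is unique.\<close>

lemma pderiv_tau_sol: "pderiv (tau_sol \<mu> p) = tau_sol \<mu> (pderiv p)"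
proof (rule tau_sol_unique)
  show "pderiv (tau_sol \<mu> p) - smult \<mu> (pderiv (pderiv (pderiv (tau_sol \<mu> p)))) = pderiv p"
    using arg_cong[OF tau_sol_ode[of \<mu> p], of pderiv] by (simp add: pderiv_diff pderiv_smult)
qed

section \<open>Boundary values of the solutions at 1\<close>

lemma poly_gegenbauer_tau_charpoly:
  "poly (gegenbauer_tau_charpoly \<gamma> n) \<mu> = poly (tau_sol \<mu> (gegenbauer \<gamma> n)) 1"
proof -
  have "degree (gegenbauer \<gamma> n) < 2 * Suc (n div 2)"
    by (rule le_less_trans[OF degree_gegenbauer_le]) presburger
  then show ?thesis
    by (simp add: gegenbauer_tau_charpoly_def tau_sol_eq[of _ "n div 2"] poly_sum poly_monom
        atMost_atLeast0 mult.commute)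
qed

lemma poly_1_tau_sol_pderiv_gegenbauer:
  assumes "\<gamma> > - 1 / 2" "n \<ge> 1"
  shows "\<exists>c>0. \<forall>\<mu>. poly (tau_sol \<mu> (pderiv (gegenbauer \<gamma> n))) 1 =
    c * poly (gegenbauer_tau_charpoly (\<gamma> + 1) (n - 1)) \<mu>"
proof (cases "n = 1")
  case True
  have "pderiv (gegenbauer \<gamma> n) = gegenbauer (\<gamma> + 1) (n - 1)" using True by (simp add: pderiv_pCons)
  then show ?thesis by (intro exI[of _ 1]) (simp add: poly_gegenbauer_tau_charpoly)
next
  case False
  then obtain m where n: "n = Suc (Suc m)" using assms(2) by (metis One_nat_def not0_implies_Suc not_one_le_zero)
  show ?thesis using assms(1) n
    by (intro exI[of _ "2 * (\<gamma> + 1)"])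
       (simp del: gegenbauer.simps add: pderiv_gegenbauer tau_sol_smult poly_gegenbauer_tau_charpoly)
qed

text \<open>With a double zero at 1, the quotients of \<open>u\<close> by \<open>(1 - x)^2\<close>
  and of \<open>u'\<close> by \<open>1 - x\<close> are polynomials, so a multiplier with denominator
  \<open>1 - x\<close> can be used without singular integrals.\<close>

lemma poly_double_root_factor:
  fixes u :: "real poly"
  assumes "poly u 1 = 0" "poly (pderiv u) 1 = 0"
  obtains r v where "u = [:1, -1:] * [:1, -1:] * r" "pderiv u = [:1, -1:] * v"
proof -
  have D: "\<exists>q. p = [:1, -1:] * q" if root: "poly p 1 = 0" for p :: "real poly"
  proof -
    obtain q where "p = [:- 1, 1:] * q" using root unfolding poly_eq_0_iff_dvd dvd_def by blast
    then have "p = [:1, -1:] * (- q)" by simp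
    then show ?thesis by blast
  qed
  obtain s where s: "u = [:1, -1:] * s" using D assms(1) by blast
  have "poly s 1 = 0" using assms(2) by (simp add: s pderiv_add pderiv_minus pderiv_pCons)
  then obtain r where "s = [:1, -1:] * r" using D by blast
  moreover obtain v where "pderiv u = [:1, -1:] * v" using D assms(2) by blast
  ultimately show ?thesis using that s by (metis mult.assoc)
qed

text \<open>The operator \<open>x D\<close> multiplies the leading term by \<open>n\<close>; the
  remainder is \<open>G_(n-1)'\<close>, of a degree low enough for orthogonality to discard
  it.\<close>

lemma euler_gegenbauer:
  assumes "n \<ge> 1"
  shows "\<exists>t. degree t \<le> n - 2 \<and>
    [:0, 1:] * pderiv (gegenbauer \<gamma> n) = smult (real n) (gegenbauer \<gamma> n) + t"
proof -
  obtain m where n: "n = Suc m" using assms by (cases n) auto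
  have "degree (pderiv (gegenbauer \<gamma> m)) \<le> n - 2"
    using degree_gegenbauer_le[of \<gamma> m] n by (simp add: degree_pderiv)
  moreover have "[:0, 1:] * pderiv (gegenbauer \<gamma> n) = smult (real n) (gegenbauer \<gamma> n) + pderiv (gegenbauer \<gamma> m)"
    using gegenbauer_pderiv_backward[of m \<gamma>] unfolding n by (intro poly_ext) simp
  ultimately show ?thesis by blast
qed

text \<open>
  The multiplier \<open>(1 + x) (2 - x) / (1 - x)\<close> of \<open>(u\<^sup>2 - \<mu> u'\<^sup>2)' = 2 u' Q\<close> is chosen so that
  the two sides of the integrated identity have opposite signs: the boundary side is minus the integral of
  \<open>u\<^sup>2 - \<mu> u'\<^sup>2\<close> against \<open>(3 - 2 \<gamma>) + 2 \<gamma> (1 - x)\<^sup>2\<close> times the weight and \<open>(1 - x)\<^sup>-\<^sup>2\<close>, whereas modulo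
  degree \<open>n - 2\<close> the multiplied \<open>u'\<close> is \<open>n b G\<^sub>n + (n - 1) a G\<^sub>n\<^sub>-\<^sub>1\<close>.
\<close>

lemma tau_no_double_boundary_root:
  assumes \<gamma>: "- 1 / 2 < \<gamma>" "\<gamma> \<le> 3 / 2" and n: "n \<ge> 2" and \<mu>: "\<mu> < 0" and ab: "a \<noteq> 0 \<or> b \<noteq> 0"
    and Q: "Q = smult b (gegenbauer \<gamma> n) + smult a (gegenbauer \<gamma> (n - 1))"
    and ode: "u - smult \<mu> (pderiv (pderiv u)) = Q"
    and u1: "poly u 1 = 0" and du1: "poly (pderiv u) 1 = 0"
  shows False
proof -
  let ?G = "gegenbauer \<gamma>" and ?L = "gegenbauer_integral \<gamma>"
  note L_lin = gegenbauer_integral_add[OF \<gamma>(1)] gegenbauer_integral_smult[OF \<gamma>(1)]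
    gegenbauer_integral_diff[OF \<gamma>(1)]
  obtain r v where u: "u = [:1, -1:] * [:1, -1:] * r" and v: "pderiv u = [:1, -1:] * v"
    using poly_double_root_factor[OF u1 du1] by blast
  have dQ: "degree Q \<le> n"
    unfolding Q using degree_gegenbauer_le[of \<gamma> n] degree_gegenbauer_le[of \<gamma> "n - 1"]
    by (intro degree_add_le order.trans[OF degree_smult_le]) auto
  have "degree u \<le> n"
    using degree_tau_sol_le[of \<mu> Q] dQ tau_sol_unique[OF ode] by simp
  then have "degree (pderiv u) \<le> n - 1" by (simp add: degree_pderiv)
  have dv: "degree v \<le> n - 2"
  proof (cases "v = 0")
    case False
    then have "degree (pderiv u) = Suc (degree v)" unfolding v by (subst degree_mult_eq) auto
    with \<open>degree (pderiv u) \<le> n - 1\<close> show ?thesis by linarith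
  qed simp
  \<comment> \<open>Since \<open>x + 2 / (1 - x) = (1 + x) (2 - x) / (1 - x)\<close>, this is the
    multiplier times \<open>u'\<close>; the part \<open>2 v\<close> has degree at most
    \<open>n - 2\<close>.\<close>
  define W where "W = [:0, 1:] * pderiv u + smult 2 v"
  have n1: "1 \<le> n" "1 \<le> n - 1" using n by auto
  obtain t1 where t1: "degree t1 \<le> n - 2"
      "[:0, 1:] * pderiv (?G n) = smult (real n) (?G n) + t1"
    using euler_gegenbauer[OF n1(1), of \<gamma>] by blast
  obtain t2 where t2: "degree t2 \<le> n - 1 - 2"
      "[:0, 1:] * pderiv (?G (n - 1)) = smult (real (n - 1)) (?G (n - 1)) + t2"
    using euler_gegenbauer[OF n1(2), of \<gamma>] by blast
  \<comment> \<open>The remainder after inserting \<open>u' = Q' + \<mu> u'''\<close> into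
    \<open>x u'\<close> and applying the Euler identity to \<open>G_n\<close> and
    \<open>G_(n-1)\<close>.\<close>
  define t where "t = smult b t1 + smult a t2 + smult \<mu> ([:0, 1:] * pderiv (pderiv (pderiv u))) + smult 2 v"
  have "degree ([:0, 1:] * pderiv (pderiv (pderiv u))) \<le> n - 2"
  proof (cases "pderiv (pderiv (pderiv u)) = 0")
    case False
    then have "degree (pderiv (pderiv u)) \<noteq> 0" by (simp add: pderiv_eq_0_iff)
    then have "degree u \<ge> 3" by (simp add: degree_pderiv)
    moreover have "degree ([:0, 1:] * pderiv (pderiv (pderiv u))) = 1 + (degree u - 3)"
      using False by (subst degree_mult_eq) (auto simp: degree_pderiv)
    ultimately show ?thesis using \<open>degree u \<le> n\<close> by linarith
  qed simp
  then have dt: "degree t \<le> n - 2"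
    unfolding t_def using t1 t2 dv by (intro degree_add_le order.trans[OF degree_smult_le]) auto
  have "pderiv u = pderiv Q + smult \<mu> (pderiv (pderiv (pderiv u)))"
    using ode by (metis add_diff_cancel_right' diff_add_cancel pderiv_add pderiv_smult)
  then have "[:0, 1:] * pderiv u = smult b ([:0, 1:] * pderiv (?G n)) + smult a ([:0, 1:] * pderiv (?G (n - 1)))
     + smult \<mu> ([:0, 1:] * pderiv (pderiv (pderiv u)))"
    unfolding Q by (simp add: pderiv_add pderiv_smult smult_add_right algebra_simps)
  then have W: "W = smult (real n * b) (?G n) + smult (real (n - 1) * a) (?G (n - 1)) + t"
    unfolding W_def t_def t1 t2 by (simp add: smult_add_right algebra_simps)
  have "degree (?G (n - 1)) < n" "degree t < n" "degree t < n - 1"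
    using degree_gegenbauer_le[of \<gamma> "n - 1"] dt n by linarith+
  then have orth: "?L (?G n * ?G (n - 1)) = 0" "?L (?G n * t) = 0" "?L (?G (n - 1) * t) = 0"
    using gegenbauer_orthogonal[OF \<gamma>(1)] by simp_all
  have orth': "?L (?G (n - 1) * ?G n) = 0" using orth(1) by (simp only: mult.commute)
  have "Q * W = smult (real n * b * b) (?G n * ?G n) + smult (real (n - 1) * a * a) (?G (n - 1) * ?G (n - 1))
     + smult (real (n - 1) * a * b) (?G n * ?G (n - 1)) + smult (real n * a * b) (?G (n - 1) * ?G n)
     + smult b (?G n * t) + smult a (?G (n - 1) * t)"
    unfolding Q W by (simp add: algebra_simps smult_add_right)
  then have QW: "?L (Q * W) = real n * b * b * ?L (?G n * ?G n) + real (n - 1) * a * a * ?L (?G (n - 1) * ?G (n - 1))"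
    by (simp only: L_lin orth orth' mult_zero_right add_0_right)
  have "?G k \<noteq> 0" for k using coeff_gegenbauer_pos[OF \<gamma>(1), of k] by auto
  then have h: "?L (?G k * ?G k) > 0" for k by (rule gegenbauer_integral_square_pos[OF \<gamma>(1)])
  have "real n * (b * b) * ?L (?G n * ?G n) + real (n - 1) * (a * a) * ?L (?G (n - 1) * ?G (n - 1)) > 0"
  proof (cases "a = 0")
    case True
    then have "b * b > 0" using ab by (auto simp: zero_less_mult_iff linorder_neq_iff)
    then show ?thesis using n h[of n] True by simp
  next
    case False
    then have "a * a > 0" by (auto simp: zero_less_mult_iff linorder_neq_iff)
    then have "real (n - 1) * (a * a) * ?L (?G (n - 1) * ?G (n - 1)) > 0"
      using n h[of "n - 1"] by simp
    moreover have "real n * (b * b) * ?L (?G n * ?G n) \<ge> 0"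
      using h[of n] zero_le_square[of b] by simp
    ultimately show ?thesis by linarith
  qed
  then have QW_pos: "?L (Q * W) > 0" unfolding QW by (simp add: mult.assoc)
  \<comment> \<open>\<open>R\<close> is \<open>(u^2 - \<mu> u'^2) / (1 - x)^2\<close>, and
    \<open>X\<close> is \<open>(3 - 2 \<gamma>) + 2 \<gamma> (1 - x)^2\<close> multiplied
    out.\<close>
  define R where "R = [:1, -1:] * [:1, -1:] * r * r - smult \<mu> (v * v)"
  define X where "X = [:3, - 4 * \<gamma>, 2 * \<gamma>:]"
  have "[:1, -1:] * [:1, -1:] * R = u * u - smult \<mu> (pderiv u * pderiv u)"
    unfolding R_def v by (subst (1 2) u, rule poly_ext) (simp add: algebra_simps)
  then have "pderiv ([:1, -1:] * [:1, -1:] * R) = pderiv (u * u - smult \<mu> (pderiv u * pderiv u))"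
    by simp
  also have "\<dots> = smult 2 (pderiv u * (u - smult \<mu> (pderiv (pderiv u))))"
    by (rule poly_ext) (simp add: pderiv_mult pderiv_diff pderiv_smult algebra_simps)
  also have "\<dots> = smult 2 (pderiv u * Q)" unfolding ode ..
  finally have D: "pderiv ([:1, -1:] * [:1, -1:] * R) = smult 2 (pderiv u * Q)" .
  \<comment> \<open>One factor \<open>1 - x\<close> is cancelled from the energy identity
    \<open>(u^2 - \<mu> u'^2)' = 2 u' Q\<close>.\<close>
  have "[:1, -1:] * ([:1, -1:] * pderiv R - smult 2 R) = [:1, -1:] * smult 2 (v * Q)"
    using arg_cong[OF D, of "\<lambda>p. poly p x" for x] unfolding v
    by (intro poly_ext)
       (simp add: pderiv_mult pderiv_pCons pderiv_add pderiv_diff pderiv_smult pderiv_minus algebra_simps)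
  then have RvQ: "[:1, -1:] * pderiv R - smult 2 R = smult 2 (v * Q)"
    by (subst (asm) mult_cancel_left) simp
  \<comment> \<open>The left side is the integration-by-parts expression of
    \<open>(2 - x) R\<close>; its factor \<open>1 - x^2\<close> supplies the \<open>1 + x\<close> of
    the multiplier and the \<open>1 - x\<close> in front of \<open>R'\<close>.\<close>
  have id: "[:1, 0, -1:] * pderiv ([:2, -1:] * R) - [:0, 2 * \<gamma> + 1:] * ([:2, -1:] * R) =
      smult 2 (Q * W) + R * X"
  proof (rule poly_ext)
    fix x
    have "(1 - x) * poly (pderiv R) x - 2 * poly R x = 2 * (poly v x * poly Q x)"
      using arg_cong[OF RvQ, of "\<lambda>p. poly p x"] by (simp add: algebra_simps)
    moreover have "poly W x = (1 + x) * (2 - x) * poly v x"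
      unfolding W_def v by (simp add: algebra_simps)
    moreover have "poly X x = 3 - 4 * \<gamma> * x + 2 * \<gamma> * x * x"
      by (simp add: X_def algebra_simps)
    moreover have "poly (pderiv ([:2, -1:] * R)) x = (2 - x) * poly (pderiv R) x - poly R x"
      by (simp add: pderiv_mult pderiv_pCons pderiv_add pderiv_smult pderiv_minus algebra_simps)
    ultimately show "poly ([:1, 0, -1:] * pderiv ([:2, -1:] * R) - [:0, 2 * \<gamma> + 1:] * ([:2, -1:] * R)) x =
        poly (smult 2 (Q * W) + R * X) x"
      unfolding poly_add poly_mult poly_diff poly_smult poly_pCons poly_0 by algebra
  qed
  have "?L (R * X) \<ge> 0"
  proof (rule gegenbauer_integral_nonneg[OF \<gamma>(1)])
    fix x :: real assume x: "x \<in> {-1..1}"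
    have "poly R x = ((1 - x) * poly r x)\<^sup>2 + - \<mu> * (poly v x)\<^sup>2"
      by (simp add: R_def power2_eq_square algebra_simps)
    moreover have "- \<mu> * (poly v x)\<^sup>2 \<ge> 0" using \<mu> by (intro mult_nonneg_nonneg) auto
    ultimately have "poly R x \<ge> 0" using zero_le_power2[of "(1 - x) * poly r x"] by linarith
    moreover have "poly X x \<ge> 0"
    proof -
      have X: "poly X x = 3 - 2 * \<gamma> + 2 * \<gamma> * (1 - x)\<^sup>2"
        by (simp add: X_def power2_eq_square algebra_simps)
      \<comment> \<open>For negative \<gamma> this bound gives
        \<open>X \<ge> 3 + 6 \<gamma> > 0\<close>; otherwise \<open>3 - 2 \<gamma> \<ge> 0\<close>
        is enough, which is where \<open>\<gamma> \<le> 3/2\<close> enters.\<close>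
      have "(1 - x)\<^sup>2 \<le> 2\<^sup>2" using x by (intro power_mono) auto
      then have sq: "(1 - x)\<^sup>2 \<le> 4" by simp
      show ?thesis
      proof (cases "\<gamma> \<ge> 0")
        case True
        then show ?thesis using \<gamma>(2) unfolding X by simp
      next
        case False
        then have "\<gamma> * (1 - x)\<^sup>2 \<ge> \<gamma> * 4" using sq by (intro mult_left_mono_neg) auto
        then show ?thesis using \<gamma>(1) unfolding X by linarith
      qed
    qed
    ultimately show "poly (R * X) x \<ge> 0" by simp
  qed
  moreover have "2 * ?L (Q * W) + ?L (R * X) = 0"
    using gegenbauer_integral_by_parts[OF \<gamma>(1), of "[:2, -1:] * R"] unfolding id by (simp add: L_lin)
  ultimately show False using QW_pos by linarith
qed

section \<open>The characteristic polynomials and their Wronskian\<close>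

lemma tau_sol_0: "tau_sol 0 p = p"
  by (rule tau_sol_unique[symmetric]) simp

lemma coeff_gegenbauer_tau_charpoly:
  "coeff (gegenbauer_tau_charpoly \<gamma> n) k =
    (if k \<le> n div 2 then poly ((pderiv ^^ (2 * k)) (gegenbauer \<gamma> n)) 1 else 0)"
  by (simp add: gegenbauer_tau_charpoly_def coeff_sum sum.delta)

lemma coeff_gegenbauer_tau_charpoly_pos:
  assumes "\<gamma> > - 1 / 2" "k \<le> n div 2"
  shows "coeff (gegenbauer_tau_charpoly \<gamma> n) k > 0"
proof -
  have "2 * k \<le> n" using assms(2) by linarith
  then show ?thesis
    using higher_pderiv_gegenbauer_at_1_pos[OF assms(1)] assms(2)
    by (simp add: coeff_gegenbauer_tau_charpoly)
qed

lemma degree_gegenbauer_tau_charpoly: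
  assumes "\<gamma> > - 1 / 2"
  shows "degree (gegenbauer_tau_charpoly \<gamma> n) = n div 2"
proof (rule antisym)
  show "degree (gegenbauer_tau_charpoly \<gamma> n) \<le> n div 2"
    by (rule degree_le) (simp add: coeff_gegenbauer_tau_charpoly)
  show "n div 2 \<le> degree (gegenbauer_tau_charpoly \<gamma> n)"
    using coeff_gegenbauer_tau_charpoly_pos[OF assms, of "n div 2" n] by (intro le_degree) simp
qed

lemma lead_coeff_gegenbauer_tau_charpoly_pos:
  assumes "\<gamma> > - 1 / 2"
  shows "lead_coeff (gegenbauer_tau_charpoly \<gamma> n) > 0"
  unfolding degree_gegenbauer_tau_charpoly[OF assms]
  by (rule coeff_gegenbauer_tau_charpoly_pos[OF assms order_refl])

lemma gegenbauer_tau_charpoly_at_0_pos: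
  assumes "\<gamma> > - 1 / 2"
  shows "poly (gegenbauer_tau_charpoly \<gamma> n) 0 > 0"
  using coeff_gegenbauer_tau_charpoly_pos[OF assms, of 0 n] by (simp add: poly_0_coeff_0)

text \<open>A vanishing determinant makes the boundary data (value and derivative at 1) of the two
  solutions linearly dependent, so a nontrivial combination would have a double zero at 1.\<close>

lemma tau_wronskian_nonzero:
  assumes \<gamma>: "- 1 / 2 < \<gamma>" "\<gamma> \<le> 3 / 2" and n: "n \<ge> 2" and \<mu>: "\<mu> < 0"
  shows "poly (tau_sol \<mu> (pderiv (gegenbauer \<gamma> n))) 1 * poly (tau_sol \<mu> (gegenbauer \<gamma> (n - 1))) 1
    \<noteq> poly (tau_sol \<mu> (gegenbauer \<gamma> n)) 1 * poly (tau_sol \<mu> (pderiv (gegenbauer \<gamma> (n - 1)))) 1"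
    (is "?O * ?E1 \<noteq> ?E * ?O1")
proof
  assume eq: "?O * ?E1 = ?E * ?O1"
  \<comment> \<open>If the second solution has zero boundary data, it is taken alone; otherwise one
    of its nonzero entries serves as \<open>b\<close>.\<close>
  obtain a b where ab: "a \<noteq> 0 \<or> b \<noteq> 0" "b * ?E + a * ?E1 = 0" "b * ?O + a * ?O1 = 0"
  proof (cases "?E1 = 0 \<and> ?O1 = 0")
    case True
    then show ?thesis by (intro that[of 1 0]) auto
  next
    case False
    show ?thesis
    proof (cases "?E1 = 0")
      case True
      then show ?thesis using False eq by (intro that[of "- ?O" "?O1"]) auto
    next
      case False
      then show ?thesis using eq by (intro that[of "- ?E" "?E1"]) (auto simp: algebra_simps)
    qed
  qed
  let ?Q = "smult b (gegenbauer \<gamma> n) + smult a (gegenbauer \<gamma> (n - 1))"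
  have "poly (tau_sol \<mu> ?Q) 1 = 0"
    using ab(2) by (simp add: tau_sol_add_smult)
  moreover have "poly (pderiv (tau_sol \<mu> ?Q)) 1 = 0"
    using ab(3) by (simp add: tau_sol_add_smult pderiv_add pderiv_smult pderiv_tau_sol)
  ultimately show False
    using tau_no_double_boundary_root[OF \<gamma> n \<mu> ab(1) refl tau_sol_ode] by blast
qed

text \<open>At \<open>x = 1\<close> the differential equation reads
  \<open>(2 \<gamma> + 1) G_k'(1) = k (k + 2 \<gamma>) G_k(1)\<close>, and
  \<open>k (k + 2 \<gamma>)\<close> grows from \<open>k = n - 1\<close> to
  \<open>k = n\<close>.\<close>

lemma tau_wronskian_at_0_pos:
  assumes \<gamma>: "- 1 / 2 < \<gamma>" and n: "n \<ge> 2"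
  shows "poly (pderiv (gegenbauer \<gamma> n)) 1 * poly (gegenbauer \<gamma> (n - 1)) 1
    > poly (gegenbauer \<gamma> n) 1 * poly (pderiv (gegenbauer \<gamma> (n - 1))) 1"
proof -
  let ?g = "\<lambda>k. poly (gegenbauer \<gamma> k) 1" and ?d = "\<lambda>k. poly (pderiv (gegenbauer \<gamma> k)) 1"
  have d: "(2 * \<gamma> + 1) * ?d k = real k * (real k + 2 * \<gamma>) * ?g k" for k
    using gegenbauer_ode[of 1 \<gamma> k] by simp
  have "real (n - 1) * (real (n - 1) + 2 * \<gamma>) < real n * (real n + 2 * \<gamma>)"
    using \<gamma> n by (simp add: of_nat_diff algebra_simps)
  moreover have "?g n * ?g (n - 1) > 0" using gegenbauer_at_1_pos[OF \<gamma>] by simp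
  ultimately have "real (n - 1) * (real (n - 1) + 2 * \<gamma>) * (?g n * ?g (n - 1)) <
      real n * (real n + 2 * \<gamma>) * (?g n * ?g (n - 1))"
    by (rule mult_strict_right_mono)
  also have "real n * (real n + 2 * \<gamma>) * (?g n * ?g (n - 1)) = (2 * \<gamma> + 1) * (?d n * ?g (n - 1))"
    using d[of n] by (simp only: mult.assoc[symmetric])
  also have "real (n - 1) * (real (n - 1) + 2 * \<gamma>) * (?g n * ?g (n - 1)) = (2 * \<gamma> + 1) * (?g n * ?d (n - 1))"
    using d[of "n - 1"] by (simp only: mult_ac)
  finally show ?thesis using \<gamma> by simp
qed

section \<open>Interlacing from sign changes\<close>

text \<open>The zeros are listed in decreasing order from index 1; \<open>\<xi> 0 = 0\<close> is a sentinel to the right of all of them.\<close>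

definition desc_zeros :: "real poly \<Rightarrow> (nat \<Rightarrow> real) \<Rightarrow> bool" where
  "desc_zeros p \<xi> \<longleftrightarrow> lead_coeff p > 0 \<and> \<xi> 0 = 0 \<and>
     (\<forall>i<degree p. \<xi> (Suc i) < \<xi> i \<and> poly p (\<xi> (Suc i)) = 0)"

lemma poly_sign_at_minus_infinity:
  fixes p :: "real poly"
  assumes "lead_coeff p > 0"
  shows "\<exists>x<t. (- 1) ^ degree p * poly p x > 0"
proof -
  define q where "q = smult ((- 1) ^ degree p) (pcompose p [:0, - 1:])"
  have "lead_coeff q = lead_coeff p"
    by (simp add: q_def lead_coeff_comp power_mult_distrib[symmetric])
  then have lc: "lead_coeff q > 0" using assms by simp
  then obtain N where N: "\<And>x. x \<ge> N \<Longrightarrow> poly q x \<ge> lead_coeff q" using poly_pinfty_gt_lc by blast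
  have "poly q (max N (1 - t)) > 0" using N[of "max N (1 - t)"] lc by linarith
  then show ?thesis
    by (intro exI[of _ "- max N (1 - t)"]) (auto simp: q_def poly_pcompose)
qed

text \<open>The intermediate value theorem gives a zero in each of the \<open>e\<close> gaps between
  the points; in degree \<open>e + 1\<close> the remaining zero lies left of \<open>t e\<close>, by
  the sign of \<open>p\<close> near minus infinity.\<close>

lemma zeros_between_sign_changes:
  fixes p :: "real poly"
  assumes lc: "lead_coeff p > 0" and e: "degree p = e \<or> degree p = Suc e"
    and t: "\<And>i. i < e \<Longrightarrow> t (Suc i) < t i" and sgn: "\<And>i. i \<le> e \<Longrightarrow> (- 1) ^ i * poly p (t i) > 0"
  shows "\<exists>\<eta>. \<forall>i<degree p. poly p (\<eta> i) = 0 \<and> \<eta> i < t i \<and> (i < e \<longrightarrow> t (Suc i) < \<eta> i)"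
proof -
  have "\<exists>x. poly p x = 0 \<and> x < t i \<and> (i < e \<longrightarrow> t (Suc i) < x)" if i: "i < degree p" for i
  proof -
    have "i \<le> e" using i e by auto
    obtain s where s: "s < t i" "(- 1) ^ Suc i * poly p s > 0" "i < e \<longrightarrow> s = t (Suc i)"
    proof (cases "i < e")
      case True
      then show ?thesis using that[of "t (Suc i)"] t sgn[of "Suc i"] by simp
    next
      case False
      then have "degree p = Suc i" using e i by auto
      then show ?thesis using that poly_sign_at_minus_infinity[OF lc, of "t i"] False by metis
    qed
    have "poly p s * poly p (t i) < 0"
      using s(2) sgn[OF \<open>i \<le> e\<close>] by (cases "even i") (auto simp: mult_less_0_iff)
    then show ?thesis using poly_IVT[OF s(1)] s(3) by blast
  qed
  then show ?thesis by metis
qed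

lemma prod_linear_factors_dvd:
  fixes p :: "'a::field poly"
  assumes "finite S" "\<And>a. a \<in> S \<Longrightarrow> poly p a = 0"
  shows "(\<Prod>a\<in>S. [:- a, 1:]) dvd p"
  using assms
proof (induction S rule: finite_induct)
  case (insert a S)
  then obtain q where q: "p = (\<Prod>a\<in>S. [:- a, 1:]) * q" by (auto elim: dvdE)
  have "poly (\<Prod>a\<in>S. [:- a, 1:]) a \<noteq> 0" using insert.hyps by (auto simp: poly_prod)
  then have "poly q a = 0" using insert.prems[of a] by (auto simp: q)
  then have "[:- a, 1:] dvd q" by (simp add: poly_eq_0_iff_dvd)
  then have "[:- a, 1:] * (\<Prod>a\<in>S. [:- a, 1:]) dvd q * (\<Prod>a\<in>S. [:- a, 1:])"
    by (rule mult_dvd_mono) (rule dvd_refl)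
  moreover have "p = q * (\<Prod>a\<in>S. [:- a, 1:])" using q by (simp only: mult.commute)
  ultimately show ?case by (simp only: prod.insert[OF insert.hyps])
qed simp

lemma desc_zeros_less:
  assumes "desc_zeros p \<xi>" "i < j" "j \<le> degree p"
  shows "\<xi> j < \<xi> i"
  using assms(2,3)
proof (induction j)
  case (Suc j)
  have "\<xi> (Suc j) < \<xi> j" using assms(1) Suc.prems by (simp add: desc_zeros_def)
  with Suc show ?case by (cases "i = j") auto
qed simp

lemma desc_zeros_inj: 
  assumes "desc_zeros p \<xi>" 
  shows "inj_on \<xi> {..degree p}"
  by (rule inj_onI) (metis assms atMost_iff desc_zeros_less less_irrefl linorder_neqE_nat)

text \<open>As many distinct zeros as the degree leave only a constant cofactor.\<close>

lemma desc_zeros_factor: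
  assumes "desc_zeros p \<xi>"
  shows "p = smult (lead_coeff p) (\<Prod>i\<in>{1..degree p}. [:- \<xi> i, 1:])"
proof -
  let ?P = "\<Prod>i\<in>{1..degree p}. [:- \<xi> i, 1:]"
  have inj: "inj_on \<xi> {1..degree p}" by (rule inj_on_subset[OF desc_zeros_inj[OF assms]]) auto
  have root: "poly p (\<xi> i) = 0" if "i \<in> {1..degree p}" for i
    using that assms by (cases i) (auto simp: desc_zeros_def)
  have "(\<Prod>a\<in>\<xi> ` {1..degree p}. [:- a, 1:]) dvd p"
    using root by (intro prod_linear_factors_dvd) auto
  then have "?P dvd p" using inj by (simp add: prod.reindex)
  then obtain q where q: "p = ?P * q" by (rule dvdE)
  have p0: "p \<noteq> 0" using assms by (auto simp: desc_zeros_def)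
  have "degree ?P = degree p"
    by (subst degree_prod_eq_sum_degree) auto
  moreover have "degree p = degree ?P + degree q" using p0 q by (metis degree_mult_eq mult_zero_left mult_zero_right)
  ultimately have "degree q = 0" by simp
  then obtain c where c: "q = [:c:]" by (rule degree_eq_zeroE)
  have "lead_coeff ?P = 1" by (simp add: lead_coeff_prod)
  moreover have "lead_coeff p = lead_coeff ?P * lead_coeff q" by (metis q lead_coeff_mult)
  ultimately have "lead_coeff p = c" using c by simp
  then show ?thesis using q c by simp
qed

lemma desc_zeros_set:
  assumes "desc_zeros p \<xi>"
  shows "{x. poly p x = 0} = \<xi> ` {1..degree p}"
proof -
  have "poly p x = lead_coeff p * (\<Prod>i\<in>{1..degree p}. x - \<xi> i)" for x
    by (subst desc_zeros_factor[OF assms]) (simp add: poly_prod)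
  moreover have "lead_coeff p \<noteq> 0" using assms unfolding desc_zeros_def by auto
  ultimately show ?thesis by auto
qed

text \<open>Exactly the linear factors of the first \<open>i\<close> zeros are negative at
  \<open>x\<close>. The guarded premises drop the right bound for \<open>i = 0\<close> and the left
  bound for \<open>i = degree p\<close>.\<close>

lemma desc_zeros_sign:
  assumes "desc_zeros p \<xi>" "i \<le> degree p" "i > 0 \<Longrightarrow> x < \<xi> i" "i < degree p \<Longrightarrow> \<xi> (Suc i) < x"
  shows "(- 1) ^ i * poly p x > 0"
proof -
  have eq: "{1..degree p} = {1..i} \<union> {Suc i..degree p}" using assms(2) by auto
  have "poly p x = lead_coeff p * (\<Prod>j\<in>{1..degree p}. x - \<xi> j)"
    by (subst desc_zeros_factor[OF assms(1)]) (simp add: poly_prod)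
  also have "\<dots> = lead_coeff p * ((\<Prod>j\<in>{1..i}. x - \<xi> j) * (\<Prod>j\<in>{Suc i..degree p}. x - \<xi> j))"
    by (subst eq, subst prod.union_disjoint) auto
  also have "(\<Prod>j\<in>{1..i}. x - \<xi> j) = (\<Prod>j\<in>{1..i}. (- 1) * (\<xi> j - x))" by simp
  also have "\<dots> = (- 1) ^ i * (\<Prod>j\<in>{1..i}. \<xi> j - x)" by (subst prod.distrib) simp
  finally have "(- 1) ^ i * poly p x =
      lead_coeff p * ((\<Prod>j\<in>{1..i}. \<xi> j - x) * (\<Prod>j\<in>{Suc i..degree p}. x - \<xi> j))"
    by (simp add: mult.left_commute flip: power_mult_distrib mult.assoc)
  moreover have "(\<Prod>j\<in>{1..i}. \<xi> j - x) > 0"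
  proof (rule prod_pos)
    fix j assume j: "j \<in> {1..i}"
    then have "x < \<xi> i" using assms(3) by auto
    then show "\<xi> j - x > 0" using j desc_zeros_less[OF assms(1), of j i] assms(2)
      by (cases "j = i") auto
  qed
  moreover have "(\<Prod>j\<in>{Suc i..degree p}. x - \<xi> j) > 0"
  proof (rule prod_pos)
    fix j assume j: "j \<in> {Suc i..degree p}"
    then have "\<xi> (Suc i) < x" using assms(4) by auto
    then show "x - \<xi> j > 0" using j desc_zeros_less[OF assms(1), of "Suc i" j]
      by (cases "j = Suc i") auto
  qed
  moreover have "lead_coeff p > 0" using assms(1) by (simp add: desc_zeros_def)
  ultimately show ?thesis by simp
qed

text \<open>Read from the right, \<open>0 > \<eta> 1 > \<xi> 1 > \<eta> 2 > \<xi> 2 > ...\<close>;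
  the sentinel lets one formula cover equal degrees and degrees differing by one.\<close>

definition desc_interlace :: "real poly \<Rightarrow> real poly \<Rightarrow> bool" where
  "desc_interlace p q \<longleftrightarrow> (\<exists>\<eta> \<xi>. desc_zeros p \<eta> \<and> desc_zeros q \<xi> \<and>
     (\<forall>i<degree p. \<eta> (Suc i) < \<xi> i) \<and> (\<forall>i<degree q. \<xi> (Suc i) < \<eta> (Suc i)))"

text \<open>The point 0, where \<open>p\<close> is positive, extends the alternation along the zeros
  of \<open>q\<close> to \<open>degree q + 1\<close> points.\<close>

lemma desc_zeros_from_sign_changes:
  assumes lc: "lead_coeff p > 0" and \<xi>: "desc_zeros q \<xi>"
    and d: "degree p = degree q \<or> degree p = Suc (degree q)" and p0: "poly p 0 > 0"
    and sgn: "\<And>i. i < degree q \<Longrightarrow> (- 1) ^ Suc i * poly p (\<xi> (Suc i)) > 0"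
  obtains \<eta> where "desc_zeros p \<eta>" "\<And>i. i < degree p \<Longrightarrow> \<eta> (Suc i) < \<xi> i"
    "\<And>i. i < degree q \<Longrightarrow> \<xi> (Suc i) < \<eta> (Suc i)"
proof -
  have "(- 1) ^ i * poly p (\<xi> i) > 0" if "i \<le> degree q" for i
    using that sgn p0 \<xi> by (cases i) (auto simp: desc_zeros_def)
  moreover have "\<xi> (Suc i) < \<xi> i" if "i < degree q" for i
    using that \<xi> by (simp add: desc_zeros_def)
  ultimately obtain \<zeta> where \<zeta>: "\<forall>i<degree p. poly p (\<zeta> i) = 0 \<and> \<zeta> i < \<xi> i \<and> (i < degree q \<longrightarrow> \<xi> (Suc i) < \<zeta> i)"
    using zeros_between_sign_changes[OF lc d, of \<xi>] by blast
  \<comment> \<open>The zeros found are numbered from 0; the shift makes room for the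
    sentinel.\<close>
  define \<eta> where "\<eta> = (\<lambda>i. case i of 0 \<Rightarrow> 0 | Suc j \<Rightarrow> \<zeta> j)"
  have S: "\<eta> (Suc i) = \<zeta> i" for i by (simp add: \<eta>_def)
  have "\<eta> (Suc i) < \<eta> i" if "i < degree p" for i
  proof (cases i)
    case 0
    then show ?thesis using \<zeta> that \<xi> by (auto simp: \<eta>_def desc_zeros_def)
  next
    case (Suc j)
    then have "\<zeta> i < \<xi> (Suc j)" "\<xi> (Suc j) < \<zeta> j" using \<zeta> that d by auto
    then show ?thesis by (simp add: Suc S)
  qed
  then have "desc_zeros p \<eta>" using lc \<zeta> by (auto simp: desc_zeros_def S) (simp add: \<eta>_def)
  then show ?thesis using \<zeta> d by (intro that[of \<eta>]) (auto simp: S)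
qed


text \<open>With \<open>p, q\<close> for \<open>\<Omega>\<^sub>n, O\<^sub>n\<close> and
  \<open>p1, q1\<close> for their predecessors: at zeros of \<open>p1\<close> the inequality gives
  \<open>p\<close> the sign opposite to \<open>q1\<close>, which locates the zeros of
  \<open>p\<close>; at those it gives \<open>q\<close> the sign of \<open>p1\<close>, which restores
  the hypothesis for the next degree.\<close>

lemma desc_interlace_step:
  assumes lc: "lead_coeff p > 0" and p0: "poly p 0 > 0"
    and d: "degree p = degree p1 \<or> degree p = Suc (degree p1)"
    and W: "\<And>x. x < 0 \<Longrightarrow> poly q x * poly p1 x > poly p x * poly q1 x"
    and \<xi>: "desc_zeros p1 \<xi>" and sgn: "\<And>i. i < degree p1 \<Longrightarrow> (- 1) ^ i * poly q1 (\<xi> (Suc i)) > 0"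
  obtains \<eta> where "desc_zeros p \<eta>" "\<And>i. i < degree p \<Longrightarrow> (- 1) ^ i * poly q (\<eta> (Suc i)) > 0"
    "desc_interlace p p1"
proof -
  have neg: "\<zeta> (Suc i) < 0" if "desc_zeros r \<zeta>" "i < degree r" for r \<zeta> i
    using desc_zeros_less[OF that(1), of 0 "Suc i"] that by (simp add: desc_zeros_def)
  have "(- 1) ^ Suc i * poly p (\<xi> (Suc i)) > 0" if "i < degree p1" for i
    using W[OF neg[OF \<xi> that]] sgn[OF that] that \<xi>
    by (cases "even i") (auto simp: desc_zeros_def mult_less_0_iff)
  then obtain \<eta> where \<eta>: "desc_zeros p \<eta>" and up: "\<And>i. i < degree p \<Longrightarrow> \<eta> (Suc i) < \<xi> i"
    and lo: "\<And>i. i < degree p1 \<Longrightarrow> \<xi> (Suc i) < \<eta> (Suc i)"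
    using desc_zeros_from_sign_changes[OF lc \<xi> d p0] by blast
  have "(- 1) ^ i * poly q (\<eta> (Suc i)) > 0" if i: "i < degree p" for i
  proof -
    have "(- 1) ^ i * poly p1 (\<eta> (Suc i)) > 0"
      using desc_zeros_sign[OF \<xi>, of i "\<eta> (Suc i)"] d i up lo by auto
    moreover have "poly q (\<eta> (Suc i)) * poly p1 (\<eta> (Suc i)) > 0"
      using W[OF neg[OF \<eta> i]] \<eta> i by (auto simp: desc_zeros_def)
    ultimately show ?thesis by (cases "even i") (auto simp: zero_less_mult_iff)
  qed
  moreover have "desc_interlace p p1" using \<eta> \<xi> up lo by (auto simp: desc_interlace_def)
  ultimately show ?thesis using \<eta> that by blast
qed

text \<open>The alternation of \<open>q\<close> along the zeros of \<open>p\<close> places the zeros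
  of \<open>q\<close> between them, with one further to the left if the degrees agree; hence
  \<open>p\<close> alternates along the zeros of \<open>q\<close>.\<close>

lemma desc_zeros_partner:
  assumes lc: "lead_coeff q > 0" and d: "degree q = degree p \<or> degree p = Suc (degree q)"
    and \<xi>: "desc_zeros p \<xi>" and sgn: "\<And>i. i < degree p \<Longrightarrow> (- 1) ^ i * poly q (\<xi> (Suc i)) > 0"
  obtains \<zeta> where "desc_zeros q \<zeta>" "\<And>i. i < degree q \<Longrightarrow> (- 1) ^ Suc i * poly p (\<zeta> (Suc i)) > 0"
proof (cases "degree p = 0")
  case True
  then have "degree q = 0" using d by auto
  then show ?thesis using lc by (intro that[of "\<lambda>_. 0"]) (auto simp: desc_zeros_def)
next
  case False
  then obtain e where e: "degree p = Suc e" by (cases "degree p") auto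
  have step: "\<xi> (Suc i) < \<xi> i" if "i < degree p" for i using that \<xi> by (simp add: desc_zeros_def)
  have de': "degree q = e \<or> degree q = Suc e" using d e by auto
  obtain \<zeta>' where \<zeta>': "\<forall>i<degree q. poly q (\<zeta>' i) = 0 \<and> \<zeta>' i < \<xi> (Suc i) \<and> (i < e \<longrightarrow> \<xi> (Suc (Suc i)) < \<zeta>' i)"
    using zeros_between_sign_changes[OF lc de', of "\<lambda>i. \<xi> (Suc i)"] e step sgn by auto
  define \<zeta> where "\<zeta> = (\<lambda>i. case i of 0 \<Rightarrow> 0 | Suc j \<Rightarrow> \<zeta>' j)"
  have S: "\<zeta> (Suc i) = \<zeta>' i" for i by (simp add: \<zeta>_def)
  have de: "degree q \<le> Suc e" using d e by auto
  have "\<zeta> (Suc i) < \<zeta> i" if i: "i < degree q" for i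
  proof (cases i)
    case 0
    have "\<xi> 1 < 0" using step[of 0] e \<xi> by (simp add: desc_zeros_def)
    moreover have "\<zeta>' 0 < \<xi> 1" using \<zeta>' i 0 by auto
    ultimately show ?thesis using 0 by (simp add: \<zeta>_def)
  next
    case (Suc j)
    then have "\<zeta>' i < \<xi> (Suc (Suc j))" "\<xi> (Suc (Suc j)) < \<zeta>' j" using \<zeta>' i de by auto
    then show ?thesis by (simp add: Suc S)
  qed
  then have "desc_zeros q \<zeta>" using lc \<zeta>' by (auto simp: desc_zeros_def S) (simp add: \<zeta>_def)
  moreover have "(- 1) ^ Suc i * poly p (\<zeta> (Suc i)) > 0" if i: "i < degree q" for i
    using desc_zeros_sign[OF \<xi>, of "Suc i" "\<zeta>' i"] \<zeta>' i e de by (simp add: S)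
  ultimately show ?thesis by (rule that)
qed

text \<open>At the zeros of \<open>q1\<close> the inequality leaves \<open>q * p1 > 0\<close>, so
  \<open>q\<close> inherits the alternating signs of \<open>p1\<close>.\<close>

lemma desc_interlace_partners:
  assumes lc: "lead_coeff q > 0" and q0: "poly q 0 > 0"
    and d: "degree q = degree q1 \<or> degree q = Suc (degree q1)"
    and W: "\<And>x. x < 0 \<Longrightarrow> poly q x * poly p1 x > poly p x * poly q1 x"
    and \<zeta>: "desc_zeros q1 \<zeta>" and sgn: "\<And>i. i < degree q1 \<Longrightarrow> (- 1) ^ Suc i * poly p1 (\<zeta> (Suc i)) > 0"
  shows "desc_interlace q q1"
proof -
  have "(- 1) ^ Suc i * poly q (\<zeta> (Suc i)) > 0" if i: "i < degree q1" for i
  proof -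
    have "\<zeta> (Suc i) < 0"
      using desc_zeros_less[OF \<zeta>, of 0 "Suc i"] i \<zeta> by (simp add: desc_zeros_def)
    from W[OF this] show ?thesis using sgn[OF i] \<zeta> i
      by (cases "even i") (auto simp: desc_zeros_def zero_less_mult_iff mult_less_0_iff)
  qed
  then obtain \<eta> where "desc_zeros q \<eta>" "\<And>i. i < degree q \<Longrightarrow> \<eta> (Suc i) < \<zeta> i"
    "\<And>i. i < degree q1 \<Longrightarrow> \<zeta> (Suc i) < \<eta> (Suc i)"
    using desc_zeros_from_sign_changes[OF lc \<zeta> d q0] by blast
  then show ?thesis using \<zeta> unfolding desc_interlace_def by blast
qed

lemma desc_interlace_smult:
  assumes "desc_interlace (smult a p) (smult b q)" "a > 0" "b > 0"
  shows "desc_interlace p q"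
proof -
  have "desc_zeros (smult c r) \<xi> \<longleftrightarrow> desc_zeros r \<xi>" if "c > 0" for c r \<xi>
    using that by (simp add: desc_zeros_def zero_less_mult_iff)
  then show ?thesis using assms by (simp add: desc_interlace_def)
qed

section \<open>Passage to increasing lists of zeros\<close>

lemma real_distinct_zeros_desc_zeros:
  assumes "desc_zeros p \<xi>"
  shows "real_distinct_zeros p (\<lambda>i. \<xi> (Suc (degree p) - i))"
  unfolding real_distinct_zeros_def
proof (intro conjI)
  show "p \<noteq> 0" using assms by (auto simp: desc_zeros_def)
  show "strict_mono_on {1..degree p} (\<lambda>i. \<xi> (Suc (degree p) - i))"
    by (rule strict_mono_onI, rule desc_zeros_less[OF assms]) auto
  have "(\<lambda>i. Suc (degree p) - i) ` {1..degree p} = {1..degree p}"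
  proof (intro equalityI subsetI)
    fix j assume "j \<in> {1..degree p}"
    then show "j \<in> (\<lambda>i. Suc (degree p) - i) ` {1..degree p}"
      by (intro image_eqI[of _ _ "Suc (degree p) - j"]) auto
  qed auto
  then show "{x. poly p x = 0} = (\<lambda>i. \<xi> (Suc (degree p) - i)) ` {1..degree p}"
    unfolding desc_zeros_set[OF assms] using image_image[of \<xi> "\<lambda>i. Suc (degree p) - i" "{1..degree p}"]
    by simp
qed

text \<open>Each list is reversed with respect to its own degree, so for unequal degrees the same
  increasing index belongs to decreasing indices that differ by one.\<close>

lemma strictly_interlace_desc_interlace:
  assumes "desc_interlace p q" and d: "degree p = degree q + 1 \<or> degree q = degree p"
  shows "strictly_interlace p q"
proof -
  obtain \<eta> \<xi> where \<eta>: "desc_zeros p \<eta>" and \<xi>: "desc_zeros q \<xi>"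
    and up: "\<And>i. i < degree p \<Longrightarrow> \<eta> (Suc i) < \<xi> i" and lo: "\<And>i. i < degree q \<Longrightarrow> \<xi> (Suc i) < \<eta> (Suc i)"
    using assms(1) unfolding desc_interlace_def by blast
  have up': "\<eta> j < \<xi> (j - 1)" if "1 \<le> j" "j \<le> degree p" for j using up[of "j - 1"] that by simp
  have lo': "\<xi> j < \<eta> j" if "1 \<le> j" "j \<le> degree q" for j using lo[of "j - 1"] that by simp
  define \<mu> where "\<mu> = (\<lambda>i. \<eta> (Suc (degree p) - i))"
  define \<mu>' where "\<mu>' = (\<lambda>i. \<xi> (Suc (degree q) - i))"
  have "\<mu> i < 0" if "i \<in> {1..degree p}" for i
    using desc_zeros_less[OF \<eta>, of 0 "Suc (degree p) - i"] that \<eta> by (auto simp: \<mu>_def desc_zeros_def)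
  moreover have "degree p = degree q + 1 \<and> (\<forall>i\<in>{1..degree q}. \<mu> i < \<mu>' i \<and> \<mu>' i < \<mu> (i + 1)) \<or>
      degree q = degree p \<and> (\<forall>i\<in>{1..degree p}. \<mu>' i < \<mu> i) \<and> (\<forall>i\<in>{1..<degree p}. \<mu> i < \<mu>' (i + 1))"
    using d
  proof
    assume d: "degree p = degree q + 1"
    have "\<mu> i < \<mu>' i" "\<mu>' i < \<mu> (i + 1)" if "i \<in> {1..degree q}" for i
      using up'[of "Suc (degree p) - i"] lo'[of "Suc (degree q) - i"] that d by (auto simp: \<mu>_def \<mu>'_def)
    then show ?thesis using d by blast
  next
    assume d: "degree q = degree p"
    have "\<mu>' i < \<mu> i" if "i \<in> {1..degree p}" for i
      using lo'[of "Suc (degree q) - i"] that d by (auto simp: \<mu>_def \<mu>'_def)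
    moreover have "\<mu> i < \<mu>' (i + 1)" if "i \<in> {1..<degree p}" for i
      using up'[of "Suc (degree p) - i"] that d by (auto simp: \<mu>_def \<mu>'_def)
    ultimately show ?thesis using d by blast
  qed
  ultimately show ?thesis
    unfolding strictly_interlace_def \<mu>_def \<mu>'_def
    using real_distinct_zeros_desc_zeros[OF \<eta>] real_distinct_zeros_desc_zeros[OF \<xi>] by blast
qed

section \<open>Interlacing of the characteristic polynomials\<close>

lemma gegenbauer_tau_charpoly_partner:
  assumes "\<gamma> > - 1 / 2"
  obtains c where "\<And>n. c n > 0"
    "\<And>n \<mu>. n \<ge> 1 \<Longrightarrow> poly (tau_sol \<mu> (pderiv (gegenbauer \<gamma> n))) 1 =
      poly (smult (c n) (gegenbauer_tau_charpoly (\<gamma> + 1) (n - 1))) \<mu>"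
proof -
  have "\<exists>c>0. n \<ge> 1 \<longrightarrow> (\<forall>\<mu>. poly (tau_sol \<mu> (pderiv (gegenbauer \<gamma> n))) 1 =
      c * poly (gegenbauer_tau_charpoly (\<gamma> + 1) (n - 1)) \<mu>)" for n
    using poly_1_tau_sol_pderiv_gegenbauer[OF assms, of n] zero_less_one by (cases "n \<ge> 1") blast+
  then obtain c where "\<forall>n. c n > 0 \<and> (n \<ge> 1 \<longrightarrow> (\<forall>\<mu>. poly (tau_sol \<mu> (pderiv (gegenbauer \<gamma> n))) 1 =
      c n * poly (gegenbauer_tau_charpoly (\<gamma> + 1) (n - 1)) \<mu>))" by metis
  then show ?thesis by (intro that[of c]) auto
qed

text \<open>One Wronskian inequality yields interlacing for both indices: for \<gamma> through the
  values at 1, for \<open>\<gamma> + 1\<close> through the derivatives at 1.\<close>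

lemma desc_interlace_gegenbauer_tau_charpoly_aux:
  assumes \<gamma>: "- 1 / 2 < \<gamma>" "\<gamma> \<le> 3 / 2" and n: "n \<ge> 2"
  shows "desc_interlace (gegenbauer_tau_charpoly \<gamma> n) (gegenbauer_tau_charpoly \<gamma> (n - 1))"
    and "desc_interlace (gegenbauer_tau_charpoly (\<gamma> + 1) (n - 1)) (gegenbauer_tau_charpoly (\<gamma> + 1) (n - 2))"
proof -
  obtain c where c: "\<And>n. c n > 0" and O: "\<And>n \<mu>. n \<ge> 1 \<Longrightarrow> poly (tau_sol \<mu> (pderiv (gegenbauer \<gamma> n))) 1 =
      poly (smult (c n) (gegenbauer_tau_charpoly (\<gamma> + 1) (n - 1))) \<mu>"
    using gegenbauer_tau_charpoly_partner[OF \<gamma>(1)] by blast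
  define p where "p = gegenbauer_tau_charpoly \<gamma>"
  define q where "q n = smult (c n) (gegenbauer_tau_charpoly (\<gamma> + 1) (n - 1))" for n
  have \<gamma>1: "\<gamma> + 1 > - 1 / 2" using \<gamma> by simp
  have deg: "degree (p n) = n div 2" "degree (q n) = (n - 1) div 2" for n
    using c[of n] by (simp_all add: p_def q_def degree_gegenbauer_tau_charpoly[OF \<gamma>(1)] degree_gegenbauer_tau_charpoly[OF \<gamma>1])
  have lc: "lead_coeff (p n) > 0" "lead_coeff (q n) > 0" for n
    unfolding p_def q_def lead_coeff_smult
    using c[of n] lead_coeff_gegenbauer_tau_charpoly_pos \<gamma>(1) \<gamma>1 by (auto intro!: mult_pos_pos)
  have at0: "poly (p n) 0 > 0" "poly (q n) 0 > 0" for n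
    using c[of n] gegenbauer_tau_charpoly_at_0_pos \<gamma>(1) \<gamma>1 by (auto simp: p_def q_def)
  \<comment> \<open>The Wronskian is positive at 0 and has no negative zero, so a sign change on the
    negative axis is impossible.\<close>
  have W: "poly (q n) x * poly (p (n - 1)) x > poly (p n) x * poly (q (n - 1)) x"
    if n: "n \<ge> 2" and x: "x < 0" for n x
  proof -
    define w where "w = q n * p (n - 1) - p n * q (n - 1)"
    have val: "poly w y = poly (tau_sol y (pderiv (gegenbauer \<gamma> n))) 1 * poly (tau_sol y (gegenbauer \<gamma> (n - 1))) 1
      - poly (tau_sol y (gegenbauer \<gamma> n)) 1 * poly (tau_sol y (pderiv (gegenbauer \<gamma> (n - 1)))) 1" for y
      using O[of n y] O[of "n - 1" y] n by (simp add: w_def p_def q_def poly_gegenbauer_tau_charpoly)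
    have "poly w 0 > 0"
      using tau_wronskian_at_0_pos[OF \<gamma>(1) n] by (simp add: val tau_sol_0)
    moreover have "poly w y \<noteq> 0" if "y < 0" for y
      using tau_wronskian_nonzero[OF \<gamma> n that] by (simp add: val)
    ultimately have "poly w x > 0"
      using poly_IVT_pos[OF x, of w] x by (metis linorder_neqE_linordered_idom)
    then show ?thesis by (simp add: w_def)
  qed
  \<comment> \<open>The induction starts at degree 1, where the characteristic polynomial is
    constant and the sign condition is vacuous.\<close>
  have inv: "\<exists>\<xi>. desc_zeros (p (Suc m)) \<xi> \<and>
      (\<forall>i<degree (p (Suc m)). (- 1) ^ i * poly (q (Suc m)) (\<xi> (Suc i)) > 0)" for m
  proof (induction m)
    case 0
    have "desc_zeros (p (Suc 0)) (\<lambda>_. 0)" using lc(1)[of 1] by (simp add: desc_zeros_def deg)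
    then show ?case by (intro exI[of _ "\<lambda>_. 0"]) (simp add: deg)
  next
    case (Suc m)
    then obtain \<xi> where \<xi>: "desc_zeros (p (Suc m)) \<xi>"
      "\<And>i. i < degree (p (Suc m)) \<Longrightarrow> (- 1) ^ i * poly (q (Suc m)) (\<xi> (Suc i)) > 0" by blast
    have d: "degree (p (Suc (Suc m))) = degree (p (Suc m)) \<or> degree (p (Suc (Suc m))) = Suc (degree (p (Suc m)))"
      unfolding deg by presburger
    have W': "poly (q (Suc (Suc m))) x * poly (p (Suc m)) x > poly (p (Suc (Suc m))) x * poly (q (Suc m)) x"
      if "x < 0" for x using W[of "Suc (Suc m)" x] that by simp
    show ?case using desc_interlace_step[OF lc(1) at0(1) d W' \<xi>] by blast
  qed
  obtain m where m: "n = Suc (Suc m)" using n by (metis One_nat_def Suc_1 Suc_le_D Suc_le_mono)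
  obtain \<xi> where \<xi>: "desc_zeros (p (Suc m)) \<xi>"
      "\<And>i. i < degree (p (Suc m)) \<Longrightarrow> (- 1) ^ i * poly (q (Suc m)) (\<xi> (Suc i)) > 0" using inv by blast
  have dp: "degree (p n) = degree (p (Suc m)) \<or> degree (p n) = Suc (degree (p (Suc m)))"
    unfolding deg m by presburger
  have W': "poly (q n) x * poly (p (Suc m)) x > poly (p n) x * poly (q (Suc m)) x" if "x < 0" for x
    using W[of n x] that m by simp
  have "desc_interlace (p n) (p (Suc m))"
    using desc_interlace_step[OF lc(1) at0(1) dp W' \<xi>] by blast
  then show "desc_interlace (gegenbauer_tau_charpoly \<gamma> n) (gegenbauer_tau_charpoly \<gamma> (n - 1))"
    by (simp add: p_def m)
  have dpq: "degree (q (Suc m)) = degree (p (Suc m)) \<or> degree (p (Suc m)) = Suc (degree (q (Suc m)))"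
    unfolding deg by presburger
  obtain \<zeta> where \<zeta>: "desc_zeros (q (Suc m)) \<zeta>"
      "\<And>i. i < degree (q (Suc m)) \<Longrightarrow> (- 1) ^ Suc i * poly (p (Suc m)) (\<zeta> (Suc i)) > 0"
    using desc_zeros_partner[OF lc(2) dpq \<xi>] by blast
  have dq: "degree (q n) = degree (q (Suc m)) \<or> degree (q n) = Suc (degree (q (Suc m)))"
    unfolding deg m by simp presburger
  have "desc_interlace (q n) (q (Suc m))"
    by (rule desc_interlace_partners[OF lc(2) at0(2) dq W' \<zeta>])
  then show "desc_interlace (gegenbauer_tau_charpoly (\<gamma> + 1) (n - 1)) (gegenbauer_tau_charpoly (\<gamma> + 1) (n - 2))"
    unfolding q_def m using c by (auto dest: desc_interlace_smult)
qed

text \<open>For \<open>\<gamma> > 3/2\<close> the second half of the preceding result applies with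
  index \<open>\<gamma> - 1\<close> and degree \<open>n + 1\<close>.\<close>

lemma desc_interlace_gegenbauer_tau_charpoly:
  assumes "- 1 / 2 < \<gamma>" "\<gamma> \<le> 5 / 2" "n \<ge> 2"
  shows "desc_interlace (gegenbauer_tau_charpoly \<gamma> n) (gegenbauer_tau_charpoly \<gamma> (n - 1))"
proof (cases "\<gamma> \<le> 3 / 2")
  case True
  then show ?thesis using desc_interlace_gegenbauer_tau_charpoly_aux(1) assms by blast
next
  case False
  then show ?thesis using desc_interlace_gegenbauer_tau_charpoly_aux(2)[of "\<gamma> - 1" "Suc n"] assms
    by simp
qed

section \<open>Eigenvalues of the discretization\<close>

lemma coeff_pcompose_scale:
  fixes p :: "'a::comm_ring_1 poly"
  shows "coeff (pcompose p [:0, c:]) i = c ^ i * coeff p i"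
  by (induction p arbitrary: i) (auto simp: pcompose_pCons coeff_pCons mult.assoc split: nat.splits)

text \<open>In terms of coefficients, parity passes from real to complex polynomials and shows that
  the coefficient of degree \<open>n - 1\<close> vanishes.\<close>

lemma poly_parity_iff_coeff:
  fixes p :: "'a::{idom, ring_char_0} poly"
  shows "(\<forall>x. poly p (- x) = (- 1) ^ n * poly p x) \<longleftrightarrow> (\<forall>i. (- 1) ^ i * coeff p i = (- 1) ^ n * coeff p i)"
proof -
  have "(\<forall>x. poly p (- x) = (- 1) ^ n * poly p x) \<longleftrightarrow>
      poly (pcompose p [:0, - 1:]) = poly (smult ((- 1) ^ n) p)"
    by (simp add: fun_eq_iff poly_pcompose)
  also have "\<dots> \<longleftrightarrow> pcompose p [:0, - 1:] = smult ((- 1) ^ n) p"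
    by (rule poly_eq_poly_eq_iff)
  also have "\<dots> \<longleftrightarrow> (\<forall>i. (- 1) ^ i * coeff p i = (- 1) ^ n * coeff p i)"
    by (simp add: poly_eq_iff coeff_pcompose_scale)
  finally show ?thesis .
qed

text \<open>Reflection commutes with \<open>D^2\<close>, so by uniqueness the solution has the
  parity of the right-hand side.\<close>

lemma tau_sol_parity:
  assumes "\<forall>x. poly p (- x) = (- 1) ^ n * poly p x"
  shows "poly (tau_sol \<mu> p) (- x) = (- 1) ^ n * poly (tau_sol \<mu> p) x"
proof -
  let ?R = "\<lambda>p. pcompose p [:0, - 1:]"
  have R2: "pderiv (pderiv (?R q)) = ?R (pderiv (pderiv q))" for q :: "'a poly"
    by (simp add: pderiv_pcompose pderiv_pCons pderiv_minus)
  have "?R p = smult ((- 1) ^ n) p"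
    using assms by (intro poly_ext) (simp add: poly_pcompose)
  moreover have "?R (tau_sol \<mu> p) - smult \<mu> (pderiv (pderiv (?R (tau_sol \<mu> p)))) = ?R p"
    using arg_cong[OF tau_sol_ode[of \<mu> p], of ?R] by (simp only: R2 pcompose_diff pcompose_smult)
  ultimately have "?R (tau_sol \<mu> p) = smult ((- 1) ^ n) (tau_sol \<mu> p)"
    by (metis tau_sol_unique tau_sol_smult)
  then have "poly (?R (tau_sol \<mu> p)) x = poly (smult ((- 1) ^ n) (tau_sol \<mu> p)) x" by simp
  then show ?thesis by (simp add: poly_pcompose)
qed

section \<open>Transfer to complex polynomials\<close>

abbreviation (input) complex_poly :: "real poly \<Rightarrow> complex poly" where
  "complex_poly \<equiv> map_poly complex_of_real"

lemma coeff_complex_poly [simp]: "coeff (complex_poly p) i = of_real (coeff p i)"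
  by (simp add: coeff_map_poly)

lemma degree_complex_poly [simp]: "degree (complex_poly p) = degree p"
  by (simp add: degree_map_poly)

lemma poly_complex_poly: "poly (complex_poly p) (of_real x) = of_real (poly p x)"
  by (simp add: poly_altdef)

lemma pderiv_complex_poly: "pderiv (complex_poly p) = complex_poly (pderiv p)"
  by (intro poly_eqI) (simp add: coeff_pderiv)

lemma higher_pderiv_complex_poly: "(pderiv ^^ k) (complex_poly p) = complex_poly ((pderiv ^^ k) p)"
  by (induction k) (simp_all add: pderiv_complex_poly)

lemma complex_poly_mult: "complex_poly (p * q) = complex_poly p * complex_poly q"
  by (intro poly_eqI) (simp add: coeff_mult)

lemma complex_poly_smult: "complex_poly (smult c p) = smult (of_real c) (complex_poly p)"
  by (intro poly_eqI) simp

lemma complex_poly_prod: "complex_poly (\<Prod>i\<in>A. f i) = (\<Prod>i\<in>A. complex_poly (f i))"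
  by (induction A rule: infinite_finite_induct) (simp_all add: complex_poly_mult map_poly_1')

lemma poly_complex_gegenbauer_tau_charpoly:
  "poly (complex_poly (gegenbauer_tau_charpoly \<gamma> n)) \<mu> = poly (tau_sol \<mu> (complex_poly (gegenbauer \<gamma> n))) 1"
proof -
  let ?P = "complex_poly (gegenbauer_tau_charpoly \<gamma> n)"
  have "degree (complex_poly (gegenbauer \<gamma> n)) < 2 * Suc (n div 2)"
    unfolding degree_complex_poly by (rule le_less_trans[OF degree_gegenbauer_le]) presburger
  then have "poly (tau_sol \<mu> (complex_poly (gegenbauer \<gamma> n))) 1 =
      (\<Sum>k\<le>n div 2. \<mu> ^ k * poly (complex_poly ((pderiv ^^ (2 * k)) (gegenbauer \<gamma> n))) (of_real 1))"
    by (simp add: tau_sol_eq poly_sum higher_pderiv_complex_poly)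
  also have "\<dots> = (\<Sum>k\<le>n div 2. coeff ?P k * \<mu> ^ k)"
    unfolding poly_complex_poly by (simp add: coeff_gegenbauer_tau_charpoly mult.commute)
  also have "\<dots> = poly ?P \<mu>"
  proof -
    have "degree ?P \<le> n div 2"
      unfolding degree_complex_poly by (rule degree_le) (simp add: coeff_gegenbauer_tau_charpoly)
    then show ?thesis unfolding poly_altdef
      by (intro sum.mono_neutral_right) (auto simp del: coeff_complex_poly simp: coeff_eq_0)
  qed
  finally show ?thesis ..
qed

lemma gegenbauer_orthogonal_complex:
  assumes "\<gamma> > - 1 / 2" "degree p < n"
  shows "((\<lambda>x. poly (complex_poly (gegenbauer \<gamma> n)) (of_real x) * poly p (of_real x)
     * of_real (gegenbauer_weight \<gamma> x)) has_integral 0) {-1..1}"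
proof -
  have "((\<lambda>x. poly (gegenbauer \<gamma> n * monom 1 i) x * gegenbauer_weight \<gamma> x) has_integral 0) {-1..1}"
    if "i \<le> degree p" for i
  proof -
    have "degree (monom 1 i :: real poly) < n" using that assms(2) by (simp add: degree_monom_eq)
    then have "gegenbauer_integral \<gamma> (gegenbauer \<gamma> n * monom 1 i) = 0"
      by (intro gegenbauer_orthogonal[OF assms(1)]) simp
    then show ?thesis using has_integral_gegenbauer_integral[OF assms(1)] by metis
  qed
  then have "((\<lambda>x. coeff p i * of_real (poly (gegenbauer \<gamma> n * monom 1 i) x * gegenbauer_weight \<gamma> x))
      has_integral coeff p i * of_real 0) {-1..1}" if "i \<le> degree p" for i
    using that by (intro has_integral_mult_right has_integral_of_real)
  then have "((\<lambda>x. \<Sum>i\<le>degree p. coeff p i * of_real (poly (gegenbauer \<gamma> n * monom 1 i) x * gegenbauer_weight \<gamma> x))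
      has_integral (\<Sum>i\<le>degree p. coeff p i * of_real 0)) {-1..1}"
    by (intro has_integral_sum) auto
  then show ?thesis
    by (simp add: poly_complex_poly poly_altdef[of p] poly_monom sum_distrib_left sum_distrib_right mult_ac)
qed

text \<open>At real points the polynomial with conjugated coefficients takes the conjugate value, so
  the integrand is the weighted squared modulus. The tau condition has no conjugation; this turns it
  into a norm by an admissible test polynomial.\<close>

lemma complex_poly_weighted_norm_zero:
  assumes "((\<lambda>x. poly r (of_real x) * poly (map_poly cnj r) (of_real x) * of_real (gegenbauer_weight \<gamma> x))
    has_integral 0) {-1..1}"
  shows "r = 0"
proof -
  have eq: "poly r (of_real x) * poly (map_poly cnj r) (of_real x) = of_real ((norm (poly r (of_real x)))\<^sup>2)" for x :: real
    using poly_cnj[of r "of_real x"] unfolding complex_norm_square by simp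
  have "((\<lambda>x. Re (poly r (of_real x) * poly (map_poly cnj r) (of_real x) * of_real (gegenbauer_weight \<gamma> x)))
    has_integral Re 0) {-1..1}"
    using has_integral_linear[OF assms bounded_linear_Re] by (simp add: comp_def)
  then have int: "((\<lambda>x. (norm (poly r (of_real x)))\<^sup>2 * gegenbauer_weight \<gamma> x) has_integral 0) {-1..1}"
    unfolding eq of_real_mult[symmetric] by simp
  have "(norm (poly r (of_real x)))\<^sup>2 = 0" if "x \<in> {-1<..<1}" for x :: real
    by (rule gegenbauer_weighted_integral_eq_0D[OF _ _ int that]) (auto intro!: continuous_intros)
  then have "of_real ` {-1<..<1} \<subseteq> {z. poly r z = 0}" by auto
  moreover have "infinite (complex_of_real ` {-1<..<1})"
    using infinite_Ioo[of "-1" "1::real"] by (subst finite_image_iff) (auto simp: inj_on_def)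
  ultimately show ?thesis using poly_roots_finite[of r] finite_subset by blast
qed

text \<open>The eigenfunction is the solution with \<open>\<mu> = 1 / lam\<close>: its residual is
  \<open>lam * G_n\<close>, orthogonal to all test polynomials.\<close>

lemma gegenbauer_tau_eigenvalueI:
  assumes \<gamma>: "- 1 / 2 < \<gamma>" and n: "n \<ge> 2" and lam: "lam \<noteq> 0"
    and root: "poly (complex_poly (gegenbauer_tau_charpoly \<gamma> n)) (1 / lam) = 0"
  shows "gegenbauer_tau_eigenvalue \<gamma> n lam"
proof -
  let ?G = "complex_poly (gegenbauer \<gamma> n)"
  define u where "u = tau_sol (1 / lam) ?G"
  have ode: "u - smult (1 / lam) (pderiv (pderiv u)) = ?G" by (simp add: u_def tau_sol_ode)
  have "coeff ?G n \<noteq> 0" using coeff_gegenbauer_pos[OF \<gamma>, of n] by simp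
  then have "?G \<noteq> 0" by (metis coeff_0)
  then have "u \<noteq> 0" using ode by auto
  have "degree u \<le> n"
    using degree_tau_sol_le[of "1 / lam" ?G] degree_gegenbauer_le[of \<gamma> n] by (simp add: u_def)
  have "\<forall>x. poly ?G (- x) = (- 1) ^ n * poly ?G x"
  proof -
    have "\<forall>i. (- 1) ^ i * coeff (gegenbauer \<gamma> n) i = (- 1) ^ n * coeff (gegenbauer \<gamma> n) i"
      by (subst poly_parity_iff_coeff[symmetric]) (simp add: gegenbauer_parity)
    then have "\<forall>i. complex_of_real ((- 1) ^ i * coeff (gegenbauer \<gamma> n) i) = of_real ((- 1) ^ n * coeff (gegenbauer \<gamma> n) i)"
      by (simp only: simp_thms)
    then show ?thesis
      by (simp only: poly_parity_iff_coeff coeff_complex_poly of_real_mult of_real_power of_real_minus of_real_1 simp_thms)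
  qed
  then have par: "poly u (- x) = (- 1) ^ n * poly u x" for x
    unfolding u_def by (rule tau_sol_parity)
  have u1: "poly u 1 = 0" using root by (simp add: u_def poly_complex_gegenbauer_tau_charpoly)
  have "lam * poly u x - poly (pderiv (pderiv u)) x = lam * poly ?G x" for x
    using arg_cong[OF ode, of "\<lambda>p. lam * poly p x"] lam by (simp add: algebra_simps)
  then have "((\<lambda>x::real. (lam * poly u (of_real x) - poly (pderiv (pderiv u)) (of_real x))
      * poly p (of_real x) * of_real ((1 - x\<^sup>2) powr (\<gamma> - 1 / 2))) has_integral 0) {-1..1}"
    if "degree p \<le> n - 2" for p
    using has_integral_mult_right[OF gegenbauer_orthogonal_complex[OF \<gamma>, of p n], of lam] that n
    by (simp add: gegenbauer_weight_def mult.assoc)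
  then show ?thesis
    unfolding gegenbauer_tau_eigenvalue_def
    using \<open>u \<noteq> 0\<close> \<open>degree u \<le> n\<close> par u1 par[of 1] by (intro exI[of _ u]) simp
qed

text \<open>Degree, parity and orthogonality force the residual to be a multiple of
  \<open>G_n\<close>; then \<open>u\<close> is a multiple of the solution with right-hand side
  \<open>G_n\<close>, and its boundary condition is the characteristic equation.\<close>

lemma gegenbauer_tau_eigenvalueD:
  assumes \<gamma>: "- 1 / 2 < \<gamma>" and n: "n \<ge> 2" and ev: "gegenbauer_tau_eigenvalue \<gamma> n lam"
  shows "lam \<noteq> 0 \<and> poly (complex_poly (gegenbauer_tau_charpoly \<gamma> n)) (1 / lam) = 0"
proof -
  let ?G = "complex_poly (gegenbauer \<gamma> n)" and ?w = "\<lambda>x. complex_of_real (gegenbauer_weight \<gamma> x)"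
  obtain u where u: "u \<noteq> 0" "degree u \<le> n" and par: "\<forall>x. poly u (- x) = (- 1) ^ n * poly u x"
    and u1: "poly u 1 = 0" "poly u (- 1) = 0"
    and int: "\<And>p. degree p \<le> n - 2 \<Longrightarrow> ((\<lambda>x. (lam * poly u (of_real x) - poly (pderiv (pderiv u)) (of_real x))
                * poly p (of_real x) * ?w x) has_integral 0) {-1..1}"
  proof -
    from ev obtain u where "u \<noteq> 0" "degree u \<le> n" 
       "\<forall>x. poly u (- x) = (if even n then poly u x else - poly u x)" "poly u 1 = 0" "poly u (- 1) = 0"
       "\<forall>p. degree p \<le> n - 2 \<longrightarrow> ((\<lambda>x. (lam * poly u (of_real x) - poly (pderiv (pderiv u)) (of_real x))
                * poly p (of_real x) * ?w x) has_integral 0) {-1..1}"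
      unfolding gegenbauer_tau_eigenvalue_def gegenbauer_weight_def by blast
    then show ?thesis using that[of u] by simp
  qed
  define v where "v = smult lam u - pderiv (pderiv u)"
  have intv: "((\<lambda>x. poly v (of_real x) * poly p (of_real x) * ?w x) has_integral 0) {-1..1}"
    if "degree p \<le> n - 2" for p
    using int[OF that] by (simp add: v_def)
  have deg_cnj: "degree (map_poly cnj r) = degree r" for r by (simp add: degree_map_poly)
  have lam: "lam \<noteq> 0"
  proof
    assume "lam = 0"
    \<comment> \<open>For \<open>lam = 0\<close> the residual has the degree of a test polynomial,
      so testing with its conjugate makes it zero; a nonzero \<open>u\<close> of degree at most 1
      cannot vanish at both endpoints.\<close>
    then have v: "v = - pderiv (pderiv u)" by (simp add: v_def)
    have "degree v \<le> n - 2" using u(2) by (simp add: v degree_pderiv)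
    then have "v = 0" using intv[of "map_poly cnj v"] by (intro complex_poly_weighted_norm_zero) (simp add: deg_cnj)
    then have "degree u \<le> 1" by (simp add: v pderiv_eq_0_iff degree_pderiv)
    moreover have "card {1, - 1 :: complex} \<le> card {x. poly u x = 0}"
      using u1 u(1) by (intro card_mono poly_roots_finite) auto
    moreover have "card {x. poly u x = 0} \<le> degree u" using u(1) by (rule card_poly_roots_bound)
    ultimately show False by simp
  qed
  \<comment> \<open>This constant removes the coefficient of degree \<open>n\<close> from the
    residual; parity removes that of degree \<open>n - 1\<close>.\<close>
  define c where "c = coeff v n / coeff ?G n"
  define r where "r = v - smult c ?G"
  have Gn: "coeff ?G n \<noteq> 0" using coeff_gegenbauer_pos[OF \<gamma>, of n] by simp
  have "coeff r i = 0" if i: "i > n - 2" for i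
  proof -
    consider "i = n" | "i = n - 1" | "i > n" using i n by linarith
    then show ?thesis
    proof cases
      case 1
      then show ?thesis using Gn by (simp add: r_def c_def)
    next
      case 2
      \<comment> \<open>The type is left general because this is used for the complex
        \<open>u\<close> and for the real \<open>G_n\<close>.\<close>
      have flip: "coeff p i = 0" if "(- 1) ^ i * coeff p i = (- 1) ^ n * coeff p i" for p :: "'b::{idom,ring_char_0} poly"
      proof -
        have "(- 1) ^ n = - ((- 1) ^ i :: 'b)" using 2 n by (cases n) auto
        then have "(- 1) ^ i * (2 * coeff p i) = 0" using that by (simp add: algebra_simps)
        then show ?thesis by simp
      qed
      have "coeff u i = 0" using par by (intro flip) (simp add: poly_parity_iff_coeff)
      moreover have "coeff (pderiv (pderiv u)) i = 0"
        using u(2) 2 n by (simp add: coeff_pderiv coeff_eq_0)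
      moreover have "coeff (gegenbauer \<gamma> n) i = 0"
        by (intro flip) (use poly_parity_iff_coeff[of "gegenbauer \<gamma> n" n] gegenbauer_parity in blast)
      ultimately show ?thesis by (simp add: r_def v_def)
    next
      case 3
      then show ?thesis using u(2) degree_gegenbauer_le[of \<gamma> n]
        by (simp add: r_def v_def coeff_eq_0 coeff_pderiv)
    qed
  qed
  then have dr: "degree r \<le> n - 2" by (intro degree_le) auto
  have "r = 0"
  proof (rule complex_poly_weighted_norm_zero)
    let ?p = "map_poly cnj r"
    have "degree ?p < n" using dr n by (simp add: deg_cnj)
    from has_integral_mult_right[OF gegenbauer_orthogonal_complex[OF \<gamma> this], of c]
    have "((\<lambda>x. c * (poly ?G (of_real x) * poly ?p (of_real x) * ?w x)) has_integral 0) {-1..1}" by simp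
    from has_integral_diff[OF intv[of ?p] this] dr
    show "((\<lambda>x. poly r (of_real x) * poly ?p (of_real x) * ?w x) has_integral 0) {-1..1}"
      by (simp add: r_def deg_cnj algebra_simps)
  qed
  then have "v = smult c ?G" by (simp add: r_def)
  then have "smult (1 / lam) v = smult (c / lam) ?G" by simp
  then have "u - smult (1 / lam) (pderiv (pderiv u)) = smult (c / lam) ?G"
    using lam by (simp add: v_def smult_diff_right)
  then have "u = smult (c / lam) (tau_sol (1 / lam) ?G)"
    using tau_sol_unique tau_sol_smult by metis
  then have "poly (tau_sol (1 / lam) ?G) 1 = 0" using u(1) u1(1) by auto
  then show ?thesis using lam by (simp add: poly_complex_gegenbauer_tau_charpoly)
qed

text \<open>The real factorization already splits completely, so there are no further complex zeros,
  and each zero is simple because it is not a zero of the other factors.\<close>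

lemma complex_poly_desc_zeros:
  assumes "desc_zeros p \<xi>"
  shows "{z. poly (complex_poly p) z = 0} = (\<lambda>i. complex_of_real (\<xi> i)) ` {1..degree p}"
    and "i \<in> {1..degree p} \<Longrightarrow> order (complex_of_real (\<xi> i)) (complex_poly p) = 1"
proof -
  define l where "l = complex_of_real (lead_coeff p)"
  let ?f = "\<lambda>i. [:- complex_of_real (\<xi> i), 1:]"
  have l: "l \<noteq> 0" using assms unfolding l_def desc_zeros_def by auto
  have fac: "complex_poly p = smult l (\<Prod>i\<in>{1..degree p}. ?f i)"
    by (subst desc_zeros_factor[OF assms])
       (simp add: complex_poly_smult complex_poly_prod map_poly_pCons l_def)
  then have "poly (complex_poly p) z = l * (\<Prod>i\<in>{1..degree p}. z - of_real (\<xi> i))" for z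
    by (simp add: poly_prod)
  then show "{z. poly (complex_poly p) z = 0} = (\<lambda>i. complex_of_real (\<xi> i)) ` {1..degree p}"
    using l by auto
  assume i: "i \<in> {1..degree p}"
  define h where "h = smult l (\<Prod>j\<in>{1..degree p} - {i}. ?f j)"
  have split: "complex_poly p = ?f i * h"
    unfolding fac h_def using i by (subst prod.remove[of _ i]) auto
  have "\<xi> i \<noteq> \<xi> j" if "j \<in> {1..degree p} - {i}" for j
    using inj_onD[OF desc_zeros_inj[OF assms], of i j] that i by auto
  then have h0: "poly h (of_real (\<xi> i)) \<noteq> 0" using l by (simp add: h_def poly_prod)
  then have ne: "?f i * h \<noteq> 0" unfolding mult_eq_0_iff by auto
  have "order (of_real (\<xi> i)) (?f i) = 1"
    using order_power_n_n[of "complex_of_real (\<xi> i)" 1] by simp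
  then show "order (complex_of_real (\<xi> i)) (complex_poly p) = 1"
    unfolding split order_mult[OF ne] order_0I[OF h0] by simp
qed

theorem theorem3p11:
  fixes \<gamma> :: real
  assumes "- 1 / 2 < \<gamma>" and "\<gamma> \<le> 5 / 2"
  shows "(\<forall>n\<ge>2.
      (\<forall>lam. gegenbauer_tau_eigenvalue \<gamma> n lam \<longrightarrow> lam \<in> \<real> \<and> Re lam < 0) \<and>
      card {lam. gegenbauer_tau_eigenvalue \<gamma> n lam} = n div 2 \<and>
      (\<forall>lam. gegenbauer_tau_eigenvalue \<gamma> n lam \<longleftrightarrow>
         lam \<noteq> 0 \<and> poly (map_poly complex_of_real (gegenbauer_tau_charpoly \<gamma> n)) (1 / lam) = 0) \<and>
      (\<forall>\<mu>. poly (map_poly complex_of_real (gegenbauer_tau_charpoly \<gamma> n)) \<mu> = 0 \<longrightarrow>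
         \<mu> \<in> \<real> \<and> Re \<mu> < 0 \<and>
         order \<mu> (map_poly complex_of_real (gegenbauer_tau_charpoly \<gamma> n)) = 1)) \<and>
    (\<forall>n\<ge>3. strictly_interlace (gegenbauer_tau_charpoly \<gamma> n) (gegenbauer_tau_charpoly \<gamma> (n - 1)))"
proof (intro conjI allI impI)
  fix n :: nat assume n: "n \<ge> 3"
  have "n div 2 = (n - 1) div 2 + 1 \<or> (n - 1) div 2 = n div 2" by presburger
  then show "strictly_interlace (gegenbauer_tau_charpoly \<gamma> n) (gegenbauer_tau_charpoly \<gamma> (n - 1))"
    using desc_interlace_gegenbauer_tau_charpoly[OF assms, of n] n
    by (intro strictly_interlace_desc_interlace)
       (simp_all only: degree_gegenbauer_tau_charpoly[OF assms(1)], linarith?)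
next
  fix n :: nat assume n: "n \<ge> 2"
  let ?P = "gegenbauer_tau_charpoly \<gamma> n"
  obtain \<xi> where \<xi>: "desc_zeros ?P \<xi>"
    using desc_interlace_gegenbauer_tau_charpoly[OF assms n] by (auto simp: desc_interlace_def)
  have deg: "degree ?P = n div 2" by (rule degree_gegenbauer_tau_charpoly[OF assms(1)])
  have neg: "\<xi> i < 0" if "i \<in> {1..n div 2}" for i
    using desc_zeros_less[OF \<xi>, of 0 i] that \<xi> by (simp add: deg desc_zeros_def)
  have Z: "{z. poly (complex_poly ?P) z = 0} = (\<lambda>i. complex_of_real (\<xi> i)) ` {1..n div 2}"
    using complex_poly_desc_zeros(1)[OF \<xi>] by (simp add: deg)
  show ev: "gegenbauer_tau_eigenvalue \<gamma> n lam \<longleftrightarrow> lam \<noteq> 0 \<and> poly (complex_poly ?P) (1 / lam) = 0" for lam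
    using gegenbauer_tau_eigenvalueD[OF assms(1) n] gegenbauer_tau_eigenvalueI[OF assms(1) n] by blast
  \<comment> \<open>The eigenvalues are the reciprocals of the negative zeros, which yields reality,
    sign and, by injectivity, their number.\<close>
  have E: "{lam. gegenbauer_tau_eigenvalue \<gamma> n lam} = (\<lambda>i. complex_of_real (1 / \<xi> i)) ` {1..n div 2}"
  proof (intro equalityI subsetI)
    fix lam assume "lam \<in> {lam. gegenbauer_tau_eigenvalue \<gamma> n lam}"
    then have "lam \<noteq> 0" "1 / lam \<in> {z. poly (complex_poly ?P) z = 0}" by (auto simp: ev)
    then obtain i where "i \<in> {1..n div 2}" "1 / lam = of_real (\<xi> i)" unfolding Z by auto
    then show "lam \<in> (\<lambda>i. complex_of_real (1 / \<xi> i)) ` {1..n div 2}"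
    proof (intro image_eqI[of _ _ i])
      have "lam = 1 / (1 / lam)" by simp
      also have "\<dots> = of_real (1 / \<xi> i)" unfolding \<open>1 / lam = of_real (\<xi> i)\<close> by simp
      finally show "lam = complex_of_real (1 / \<xi> i)" .
    qed
  next
    fix lam assume "lam \<in> (\<lambda>i. complex_of_real (1 / \<xi> i)) ` {1..n div 2}"
    then obtain i where i: "i \<in> {1..n div 2}" "lam = of_real (1 / \<xi> i)" by auto
    then have "1 / lam \<in> {z. poly (complex_poly ?P) z = 0}" unfolding Z by auto
    then show "lam \<in> {lam. gegenbauer_tau_eigenvalue \<gamma> n lam}" using i neg[OF i(1)] by (auto simp: ev)
  qed
  show "lam \<in> \<real>" "Re lam < 0" if "gegenbauer_tau_eigenvalue \<gamma> n lam" for lam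
  proof -
    have "lam \<in> (\<lambda>i. complex_of_real (1 / \<xi> i)) ` {1..n div 2}" using that unfolding E[symmetric] by simp
    then obtain i where "i \<in> {1..n div 2}" "lam = of_real (1 / \<xi> i)" by (elim imageE)
    then show "lam \<in> \<real>" "Re lam < 0" using neg[of i] by auto
  qed
  have "inj_on (\<lambda>i. complex_of_real (1 / \<xi> i)) {1..n div 2}"
  proof (rule inj_onI)
    fix i j assume i: "i \<in> {1..n div 2}" and j: "j \<in> {1..n div 2}"
      and "complex_of_real (1 / \<xi> i) = complex_of_real (1 / \<xi> j)"
    then have "\<xi> i = \<xi> j" using neg[OF i] neg[OF j] by simp
    then show "i = j" using inj_onD[OF desc_zeros_inj[OF \<xi>]] i j by (simp add: deg)
  qed
  then show "card {lam. gegenbauer_tau_eigenvalue \<gamma> n lam} = n div 2"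
    unfolding E by (subst card_image) simp_all
  show "\<mu> \<in> \<real>" "Re \<mu> < 0" "order \<mu> (complex_poly ?P) = 1" if "poly (complex_poly ?P) \<mu> = 0" for \<mu>
  proof -
    have "\<mu> \<in> (\<lambda>i. complex_of_real (\<xi> i)) ` {1..n div 2}" using that unfolding Z[symmetric] by simp
    then obtain i where "i \<in> {1..n div 2}" "\<mu> = of_real (\<xi> i)" by (elim imageE)
    then show "\<mu> \<in> \<real>" "Re \<mu> < 0" "order \<mu> (complex_poly ?P) = 1"
      using neg[of i] complex_poly_desc_zeros(2)[OF \<xi>, of i] by (auto simp: deg)
  qed
qed

end
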